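(* Let $t=(\mathcal{G},\sigma,\Omega)$ be a symplectic symmetric triple such that $\mathcal{G}$ is neither solvable nor semisimple. Then $t$ admits a unique maximal semisimple factor $t_{\mathcal{L}}$. In other words, if $t=t_{\mathcal{L}_1}\oplus t_1=t_{\mathcal{L}_2}\oplus t_2$ are two decompositions where $t_{\mathcal{L}_i}$ is maximal semisimple ($i=1,2$), with underlying Lie algebra $\mathcal{L}_i$, then $\mathcal{L}_1=\mathcal{L}_2$.
   Context: A symplectic symmetric triple is a triple $t=(\mathcal{G},\sigma,\Omega)$ where: (i) $\mathcal{G}$ is a finite-dimensional real Lie algebra; (ii) $\sigma$ is an involutive automorphism of $\mathcal{G}$ such that, writing $\mathcal{G}=\mathcal{K}\oplus\mathcal{P}$ with $\sigma=\mathrm{id}_{\mathcal{K}}\oplus(-\mathrm{id}_{\mathcal{P}})$, one has $[\mathcal{P},\mathcal{P}]=\mathcal{K}$ and $\mathcal{K}$ acts faithfully on $\mathcal{P}$; (iii) $\Omega$ is a $\mathcal{K}$-invariant symplectic form on $\mathcal{P}$. Direct sums of triples are defined in the obvious way (direct sum of Lie algebras, of involutions, orthogonal direct sum of forms). If $t=t_{\mathcal{L}}\oplus t_1$ is a decomposition where $t_{\mathcal{L}}=(\mathcal{L},\sigma|_{\mathcal{L}},\Omega_{\mathcal{L}})$ is a semisimple triple (i.e. $\mathcal{L}$ is semisimple), $t_{\mathcal{L}}$ is called a semisimple factor of $t$; it is maximal if $t_1$ admits no (non-zero) semisimple factor. The zero triple is allowed as semisimple factor. *)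

theory Defs
  imports Complex_Main
begin

text \<open>Lie algebras are modelled on finite-dimensional linear subspaces of an arbitrary real
  vector space type, so that ideals and direct summands are again objects of the same kind.
  Operations are only constrained on the carrier.\<close>

definition finite_dim_subspace :: "'a::real_vector set \<Rightarrow> bool" where
  "finite_dim_subspace V \<longleftrightarrow> (\<exists>B. finite B \<and> V = span B)"

definition linear_on :: "'a::real_vector set \<Rightarrow> ('a \<Rightarrow> 'b::real_vector) \<Rightarrow> bool" where
  "linear_on V f \<longleftrightarrow>
     (\<forall>x\<in>V. \<forall>y\<in>V. f (x + y) = f x + f y) \<and> (\<forall>c. \<forall>x\<in>V. f (c *\<^sub>R x) = c *\<^sub>R f x)"

definition bilinear_on :: "'a::real_vector set \<Rightarrow> ('a \<Rightarrow> 'a \<Rightarrow> 'b::real_vector) \<Rightarrow> bool" where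
  "bilinear_on V f \<longleftrightarrow>
     (\<forall>x\<in>V. linear_on V (\<lambda>y. f x y)) \<and> (\<forall>y\<in>V. linear_on V (\<lambda>x. f x y))"

definition lie_algebra :: "'a::real_vector set \<Rightarrow> ('a \<Rightarrow> 'a \<Rightarrow> 'a) \<Rightarrow> bool" where
  "lie_algebra V br \<longleftrightarrow>
     finite_dim_subspace V \<and>
     (\<forall>x\<in>V. \<forall>y\<in>V. br x y \<in> V) \<and>
     bilinear_on V br \<and>
     (\<forall>x\<in>V. br x x = 0) \<and>
     (\<forall>x\<in>V. \<forall>y\<in>V. \<forall>z\<in>V. br x (br y z) + br y (br z x) + br z (br x y) = 0)"

definition bracket_span ::
    "('a::real_vector \<Rightarrow> 'a \<Rightarrow> 'a) \<Rightarrow> 'a set \<Rightarrow> 'a set \<Rightarrow> 'a set" where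
  "bracket_span br A B = span {br x y | x y. x \<in> A \<and> y \<in> B}"

fun derived_series :: "('a::real_vector \<Rightarrow> 'a \<Rightarrow> 'a) \<Rightarrow> 'a set \<Rightarrow> nat \<Rightarrow> 'a set" where
  "derived_series br V 0 = V"
| "derived_series br V (Suc n) = bracket_span br (derived_series br V n) (derived_series br V n)"

definition lie_solvable :: "'a::real_vector set \<Rightarrow> ('a \<Rightarrow> 'a \<Rightarrow> 'a) \<Rightarrow> bool" where
  "lie_solvable V br \<longleftrightarrow> (\<exists>n. derived_series br V n = {0})"

definition lie_ideal :: "'a::real_vector set \<Rightarrow> 'a set \<Rightarrow> ('a \<Rightarrow> 'a \<Rightarrow> 'a) \<Rightarrow> bool" where
  "lie_ideal I V br \<longleftrightarrow> subspace I \<and> I \<subseteq> V \<and> (\<forall>x\<in>V. \<forall>y\<in>I. br x y \<in> I)"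

text \<open>Semisimple means vanishing radical; in particular the zero algebra is semisimple.\<close>

definition lie_semisimple :: "'a::real_vector set \<Rightarrow> ('a \<Rightarrow> 'a \<Rightarrow> 'a) \<Rightarrow> bool" where
  "lie_semisimple V br \<longleftrightarrow> (\<forall>I. lie_ideal I V br \<and> lie_solvable I br \<longrightarrow> I = {0})"

record 'a triple =
  carrier :: "'a set"
  bracket :: "'a \<Rightarrow> 'a \<Rightarrow> 'a"
  invol :: "'a \<Rightarrow> 'a"
  form :: "'a \<Rightarrow> 'a \<Rightarrow> real"

definition K_part :: "'a::real_vector triple \<Rightarrow> 'a set" where
  "K_part t = {x \<in> carrier t. invol t x = x}"

definition P_part :: "'a::real_vector triple \<Rightarrow> 'a set" where
  "P_part t = {x \<in> carrier t. invol t x = - x}"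

definition involutive_automorphism ::
    "'a::real_vector set \<Rightarrow> ('a \<Rightarrow> 'a \<Rightarrow> 'a) \<Rightarrow> ('a \<Rightarrow> 'a) \<Rightarrow> bool" where
  "involutive_automorphism V br s \<longleftrightarrow>
     (\<forall>x\<in>V. s x \<in> V) \<and> linear_on V s \<and> (\<forall>x\<in>V. s (s x) = x) \<and>
     (\<forall>x\<in>V. \<forall>y\<in>V. s (br x y) = br (s x) (s y))"

definition symplectic_on :: "'a::real_vector set \<Rightarrow> ('a \<Rightarrow> 'a \<Rightarrow> real) \<Rightarrow> bool" where
  "symplectic_on V w \<longleftrightarrow>
     bilinear_on V w \<and> (\<forall>x\<in>V. \<forall>y\<in>V. w x y = - w y x) \<and>
     (\<forall>x\<in>V. (\<forall>y\<in>V. w x y = 0) \<longrightarrow> x = 0)"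

definition symplectic_symmetric_triple :: "'a::real_vector triple \<Rightarrow> bool" where
  "symplectic_symmetric_triple t \<longleftrightarrow>
     lie_algebra (carrier t) (bracket t) \<and>
     involutive_automorphism (carrier t) (bracket t) (invol t) \<and>
     bracket_span (bracket t) (P_part t) (P_part t) = K_part t \<and>
     (\<forall>k\<in>K_part t. (\<forall>p\<in>P_part t. bracket t k p = 0) \<longrightarrow> k = 0) \<and>
     symplectic_on (P_part t) (form t) \<and>
     (\<forall>k\<in>K_part t. \<forall>x\<in>P_part t. \<forall>y\<in>P_part t.
        form t (bracket t k x) y + form t x (bracket t k y) = 0)"

text \<open>Internal direct sums: \<open>t = t1 \<oplus> t2\<close>, where the carriers of \<open>t1\<close> and \<open>t2\<close> are
  complementary subspaces of that of \<open>t\<close> and all structure on \<open>t\<close> is componentwise. Taking one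
  component to be zero shows that the structure of each summand is the restriction of that of \<open>t\<close>,
  that the summands commute, and that their \<open>P\<close>-parts are orthogonal.\<close>

definition triple_direct_sum ::
    "'a::real_vector triple \<Rightarrow> 'a triple \<Rightarrow> 'a triple \<Rightarrow> bool" where
  "triple_direct_sum t t1 t2 \<longleftrightarrow>
     symplectic_symmetric_triple t1 \<and> symplectic_symmetric_triple t2 \<and>
     carrier t = {x1 + x2 | x1 x2. x1 \<in> carrier t1 \<and> x2 \<in> carrier t2} \<and>
     carrier t1 \<inter> carrier t2 = {0} \<and>
     (\<forall>x1\<in>carrier t1. \<forall>x2\<in>carrier t2. \<forall>y1\<in>carrier t1. \<forall>y2\<in>carrier t2.
        bracket t (x1 + x2) (y1 + y2) = bracket t1 x1 y1 + bracket t2 x2 y2) \<and>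
     (\<forall>x1\<in>carrier t1. \<forall>x2\<in>carrier t2. invol t (x1 + x2) = invol t1 x1 + invol t2 x2) \<and>
     (\<forall>x1\<in>P_part t1. \<forall>x2\<in>P_part t2. \<forall>y1\<in>P_part t1. \<forall>y2\<in>P_part t2.
        form t (x1 + x2) (y1 + y2) = form t1 x1 y1 + form t2 x2 y2)"

definition semisimple_triple :: "'a::real_vector triple \<Rightarrow> bool" where
  "semisimple_triple t \<longleftrightarrow>
     symplectic_symmetric_triple t \<and> lie_semisimple (carrier t) (bracket t)"

definition semisimple_factor :: "'a::real_vector triple \<Rightarrow> 'a triple \<Rightarrow> bool" where
  "semisimple_factor t tL \<longleftrightarrow> semisimple_triple tL \<and> (\<exists>t1. triple_direct_sum t tL t1)"

definition maximal_semisimple_decomposition ::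
    "'a::real_vector triple \<Rightarrow> 'a triple \<Rightarrow> 'a triple \<Rightarrow> bool" where
  "maximal_semisimple_decomposition t tL t1 \<longleftrightarrow>
     semisimple_triple tL \<and> triple_direct_sum t tL t1 \<and>
     \<not> (\<exists>s. semisimple_factor t1 s \<and> carrier s \<noteq> {0})"

end

theory Submission
  imports Defs
begin

text \<open>
  Uniqueness rests on one structural fact: the Lie algebra of a semisimple triple is perfect,
  \<open>\<L> = [\<L>, \<L>]\<close>. Granting it, let \<open>\<G> = \<L>\<^sub>1 \<oplus> \<U>\<^sub>1 = \<L>\<^sub>2 \<oplus> \<U>\<^sub>2\<close> be two decompositions into ideals with
  \<open>\<L>\<^sub>1\<close> semisimple. Then
  \<open>\<L>\<^sub>1 = [\<L>\<^sub>1, \<L>\<^sub>1] \<subseteq> [\<L>\<^sub>1, \<L>\<^sub>2] + [\<L>\<^sub>1, \<U>\<^sub>2] \<subseteq> (\<L>\<^sub>1 \<inter> \<L>\<^sub>2) + (\<L>\<^sub>1 \<inter> \<U>\<^sub>2)\<close>,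
  so \<open>\<L>\<^sub>1 \<inter> \<U>\<^sub>2\<close> is a direct factor of \<open>\<L>\<^sub>1\<close>, hence semisimple, and it is complemented in \<open>\<U>\<^sub>2\<close> by
  \<open>\<U>\<^sub>2 \<inter> ((\<L>\<^sub>1 \<inter> \<L>\<^sub>2) + \<U>\<^sub>1)\<close>. The two pieces are orthogonal because each of the given decompositions is,
  so \<open>\<L>\<^sub>1 \<inter> \<U>\<^sub>2\<close> is a semisimple factor of the second complement. If that complement has none but
  zero, \<open>\<L>\<^sub>1 \<subseteq> \<L>\<^sub>2\<close>; equality follows by symmetry
  (\<open>semisimple_subset_of_factor_free_complement\<close>).

  Perfectness (\<open>semisimple_perfect\<close>) follows from the symplectic form together with a
  general fact on Lie algebras. Since \<open>\<K> = [\<P>, \<P>]\<close>, only \<open>[\<K>, \<P>] = \<P>\<close> is in question. By invariance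
  of \<open>\<Omega>\<close>, the orthogonal of \<open>[\<K>, \<P>]\<close> consists of the \<open>x \<in> \<P>\<close> with \<open>[\<K>, x] = 0\<close>. For such \<open>x\<close> one has
  \<open>[x, \<P>] \<subseteq> \<K>\<close>, so \<open>(ad x)\<^sup>2 = 0\<close>: the element \<open>x\<close> is a sandwich. The general fact
  (\<open>semisimple_sandwich_zero\<close>) is that a Lie algebra without non-zero solvable ideals has no non-zero
  sandwich. Its proof has three steps.

  \<^item> If \<open>(ad x)\<^sup>2 = 0\<close> then \<open>ad x \<circ> ad y \<circ> ad x = 0\<close> for all \<open>y\<close>, and therefore the set of sandwiches
    is closed under the bracket (\<open>br_sandwich\<close>).

  \<^item> As in the theorem of Engel and Jacobson, a set of sandwiches closed under the bracket acts
    nilpotently: a maximal bracket-closed subset with nilpotent action is normalized by some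
    sandwich outside it unless it is everything, and can then be enlarged
    (\<open>sandwiches_act_nilpotently\<close>).

  \<^item> The automorphism \<open>exp (t ad y)\<close> permutes the sandwiches, so their linear span is stable under
    its derivative \<open>ad y\<close> at \<open>t = 0\<close> and is an ideal (\<open>br_sandwich_in_span\<close>). By the previous step
    this ideal is nilpotent, hence zero.

  Existence is a dimension count: \<open>0 \<oplus> t\<close> is a decomposition, and if the complement of a
  semisimple factor still has a non-zero semisimple factor, the sum of the two is a semisimple factor
  of larger dimension (\<open>enlarge_semisimple_factor\<close>).
\<close>

section \<open>Subspaces of finite dimension\<close>

lemma finite_dim_subspace_subspace: "finite_dim_subspace V \<Longrightarrow> subspace V"
  unfolding finite_dim_subspace_def by auto

lemma finite_dim_subspace_basis:
  assumes "finite_dim_subspace V"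
  obtains B where "finite B" "independent B" "span B = V"
proof -
  obtain W where W: "finite W" "V = span W"
    using assms unfolding finite_dim_subspace_def by auto
  obtain B where B: "B \<subseteq> V" "independent B" "V \<subseteq> span B"
    using real_vector.maximal_independent_subset by blast
  have "finite B"
    using real_vector.independent_span_bound[OF W(1) B(2)] B(1) W(2) by auto
  moreover have "span B = V"
    using B W by (metis real_vector.span_minimal real_vector.subspace_span subset_antisym)
  ultimately show ?thesis using that B(2) by blast
qed

lemma finite_dim_subspace_mono:
  assumes "finite_dim_subspace V" "subspace S" "S \<subseteq> V"
  shows "finite_dim_subspace S"
proof -
  obtain W where W: "finite W" "V = span W"
    using assms unfolding finite_dim_subspace_def by auto
  obtain B where B: "B \<subseteq> S" "independent B" "S \<subseteq> span B"
    using real_vector.maximal_independent_subset by blast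
  have "finite B"
    using real_vector.independent_span_bound[OF W(1) B(2)] B(1) W(2) assms(3) by auto
  moreover have "span B = S"
    using B assms(2) by (metis real_vector.span_minimal subset_antisym)
  ultimately show ?thesis unfolding finite_dim_subspace_def by blast
qed

lemma dim_le_of_subset:
  assumes "finite_dim_subspace V" "S \<subseteq> V"
  shows "dim S \<le> dim V"
proof -
  obtain B where B: "finite B" "independent B" "span B = V"
    using finite_dim_subspace_basis[OF assms(1)] .
  have "dim V = card B" using B(2,3) real_vector.dim_span_eq_card_independent by blast
  then show ?thesis using real_vector.dim_le_card[of S B] B assms by simp
qed

lemma subspace_eq_of_dim_le:
  assumes V: "finite_dim_subspace V" and S: "subspace S" "S \<subseteq> V" and d: "dim V \<le> dim S"
  shows "S = V"
proof -
  obtain A where A: "finite A" "independent A" "span A = S"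
    using finite_dim_subspace_basis finite_dim_subspace_mono[OF V S] by blast
  obtain W where W: "finite W" "V = span W"
    using V unfolding finite_dim_subspace_def by auto
  have "A \<subseteq> V" using A S real_vector.span_superset by blast
  then obtain B where B: "A \<subseteq> B" "B \<subseteq> V" "independent B" "V \<subseteq> span B"
    using real_vector.maximal_independent_subset_extend A(2) by metis
  have fB: "finite B" using real_vector.independent_span_bound[OF W(1) B(3)] B(2) W(2) by auto
  have "span B = V"
    using B finite_dim_subspace_subspace[OF V] by (metis real_vector.span_minimal subset_antisym)
  then have "dim V = card B" using B(3) real_vector.dim_span_eq_card_independent by blast
  moreover have "dim S = card A" using A real_vector.dim_span_eq_card_independent by blast
  ultimately have "A = B" using d B(1) fB by (simp add: card_seteq)
  then show ?thesis using A(3) \<open>span B = V\<close> by simp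
qed

lemma exists_linear_separating:
  assumes S: "subspace S" and v: "v \<notin> S"
  obtains f :: "'a::real_vector \<Rightarrow> real" where "linear f" "\<And>x. x \<in> S \<Longrightarrow> f x = 0" "f v = 1"
proof -
  obtain B where B: "B \<subseteq> S" "independent B" "S \<subseteq> span B"
    using real_vector.maximal_independent_subset by blast
  have sB: "span B = S" using B S by (metis real_vector.span_minimal subset_antisym)
  then have "v \<notin> span B" using v by simp
  then have "independent (insert v B)"
    using B(2) real_vector.independent_insertI by blast
  then obtain f :: "'a \<Rightarrow> real" where f: "linear f" "\<forall>x\<in>insert v B. f x = (if x = v then 1 else 0)"
    using linear_independent_extend[of "insert v B" "\<lambda>x. if x = v then 1 else 0"] by blast
  have "f x = 0" if "x \<in> S" for x
  proof -
    have "x \<in> span B" using that sB by simp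
    then show ?thesis
      using linear_eq_0_on_span[OF f(1), of B x] f(2) \<open>v \<notin> span B\<close> real_vector.span_base by fastforce
  qed
  with f that show ?thesis by auto
qed

text \<open>Functions that are linear only on a carrier extend to linear functions on the whole type, which
  makes the library on \<open>linear\<close> applicable.\<close>

lemma linear_on_eq_linear:
  assumes "independent B" "linear_on (span B) f"
  obtains g where "linear g" "\<And>x. x \<in> span B \<Longrightarrow> g x = f x"
proof -
  obtain g where g: "linear g" "\<forall>x\<in>B. g x = f x"
    using linear_independent_extend[OF assms(1)] by blast
  have "x \<in> span B \<and> g x = f x" if "x \<in> span B" for x
    using that
  proof (induction x rule: real_vector.span_induct_alt)
    case base
    have "f (0 *\<^sub>R 0) = 0 *\<^sub>R f 0"
      using assms(2) real_vector.span_zero unfolding linear_on_def by blast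
    then show ?case using linear_0[OF g(1)] by (simp add: real_vector.span_zero)
  next
    case (step c x y)
    have m: "x \<in> span B" "c *\<^sub>R x \<in> span B" "y \<in> span B"
      using step by (simp_all add: real_vector.span_base real_vector.span_scale)
    then have "f (c *\<^sub>R x + y) = c *\<^sub>R f x + f y"
      using assms(2) unfolding linear_on_def by simp
    moreover have "g (c *\<^sub>R x + y) = c *\<^sub>R g x + g y"
      by (simp add: linear_add[OF g(1)] linear_scale[OF g(1)])
    ultimately show ?case using step(1,2) m g(2) by (simp add: real_vector.span_add)
  qed
  with g that show ?thesis by blast
qed

text \<open>For a basis \<open>A\<close> of \<open>Q\<close>, the map \<open>x \<mapsto> (w x a)\<^sub>a\<close> can be read as a linear map from \<open>V\<close> to the
  smaller space \<open>Q\<close>. It has a kernel, and the kernel is orthogonal to \<open>Q\<close>.\<close>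

lemma exists_orthogonal_vector:
  fixes w :: "'a::real_vector \<Rightarrow> 'a \<Rightarrow> real"
  assumes V: "finite_dim_subspace V" and w: "bilinear_on V w"
    and Q: "subspace Q" "Q \<subseteq> V" "Q \<noteq> V"
  obtains x where "x \<in> V" "x \<noteq> 0" "\<And>q. q \<in> Q \<Longrightarrow> w x q = 0"
proof -
  obtain A where A: "finite A" "independent A" "span A = Q"
    using finite_dim_subspace_basis finite_dim_subspace_mono[OF V Q(1,2)] by blast
  obtain B where B: "finite B" "independent B" "span B = V"
    using finite_dim_subspace_basis[OF V] .
  define g where "g x = (\<Sum>a\<in>A. w x a *\<^sub>R a)" for x
  have AV: "a \<in> V" if "a \<in> A" for a using that A Q by (metis real_vector.span_base subsetD)
  have sV: "subspace V" using finite_dim_subspace_subspace[OF V] .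
  have "linear_on (span B) g"
    unfolding linear_on_def g_def B(3) using w AV
    by (simp add: bilinear_on_def linear_on_def scaleR_add_left sum.distrib scaleR_sum_right)
  then obtain h where h: "linear h" "\<And>x. x \<in> span B \<Longrightarrow> h x = g x"
    using linear_on_eq_linear[OF B(2)] by blast
  have gQ: "g x \<in> Q" for x
    unfolding g_def using A(3) Q(1)
    by (intro real_vector.subspace_sum real_vector.subspace_scale) (auto intro: real_vector.span_base)
  \<comment> \<open>an injective \<open>h\<close> would carry the basis \<open>B\<close> of \<open>V\<close> to an independent subset of \<open>Q\<close>\<close>
  have "\<not> inj_on h (span B)"
  proof
    assume i: "inj_on h (span B)"
    then have ind: "independent (h ` B)"
      using linear_independent_injective_image[OF h(1) B(2)] by blast
    have "h ` B \<subseteq> span A" using h(2) gQ A(3) real_vector.span_base by fastforce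
    then have "card (h ` B) \<le> card A"
      using real_vector.independent_span_bound[OF A(1) ind] by blast
    moreover have "card (h ` B) = card B"
      using i by (meson card_image inj_on_subset real_vector.span_superset)
    ultimately have "dim V \<le> dim Q"
      using A B real_vector.dim_span_eq_card_independent by metis
    then show False using subspace_eq_of_dim_le[OF V Q(1,2)] Q(3) by blast
  qed
  then obtain x where x: "x \<in> span B" "x \<noteq> 0" "h x = 0"
    using linear_inj_on_iff_eq_0[OF h(1), of "span B"] by auto
  have xV: "x \<in> V" using x B by simp
  have g0: "(\<Sum>a\<in>A. w x a *\<^sub>R a) = 0" using x h(2) g_def by metis
  have wA: "w x a = 0" if "a \<in> A" for a
    using real_vector.independentD[OF A(2,1) _ g0 that] by simp
  have "w x q = 0" if "q \<in> Q" for q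
  proof -
    have "linear_on V (w x)" using w xV unfolding bilinear_on_def by blast
    then have l: "linear_on (span A) (w x)" using Q A(3) unfolding linear_on_def by blast
    then obtain k where k: "linear k" "\<And>y. y \<in> span A \<Longrightarrow> k y = w x y"
      using linear_on_eq_linear[OF A(2)] by metis
    have "k q = 0"
      using linear_eq_0_on_span[OF k(1), of A q] k(2) wA that A(3) real_vector.span_base by metis
    then show ?thesis using k(2) that A(3) by simp
  qed
  with that xV x show ?thesis by blast
qed

section \<open>Lie algebras\<close>

lemma bracket_spanI: "x \<in> A \<Longrightarrow> y \<in> B \<Longrightarrow> br x y \<in> bracket_span br A B"
  unfolding bracket_span_def by (blast intro: real_vector.span_base)

lemma subspace_bracket_span [simp]: "subspace (bracket_span br A B)"
  unfolding bracket_span_def by simp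

lemma bracket_span_least:
  "(\<And>x y. x \<in> A \<Longrightarrow> y \<in> B \<Longrightarrow> br x y \<in> S) \<Longrightarrow> subspace S \<Longrightarrow> bracket_span br A B \<subseteq> S"
  unfolding bracket_span_def by (rule real_vector.span_minimal) auto

lemma bracket_span_mono:
  "A \<subseteq> A' \<Longrightarrow> B \<subseteq> B' \<Longrightarrow> bracket_span br A B \<subseteq> bracket_span br A' B'"
  by (rule bracket_span_least) (auto intro: bracket_spanI)

lemma derived_series_mono:
  assumes "U \<subseteq> V" shows "derived_series br U n \<subseteq> derived_series br V n"
  by (induction n) (use assms in \<open>auto intro: bracket_span_mono[THEN subsetD]\<close>)

lemma subspace_derived_series:
  "subspace V \<Longrightarrow> subspace (derived_series br V n)"
  by (cases n) auto

text \<open>The summands of a triple carry brackets of their own that agree with the ambient one only on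
  their carriers; this transports solvability between the two.\<close>

lemma derived_series_cong:
  assumes V: "subspace V" "\<And>x y. x \<in> V \<Longrightarrow> y \<in> V \<Longrightarrow> br x y \<in> V"
    and eq: "\<And>x y. x \<in> V \<Longrightarrow> y \<in> V \<Longrightarrow> br x y = br' x y"
  shows "derived_series br V n = derived_series br' V n \<and> derived_series br V n \<subseteq> V"
proof (induction n)
  case (Suc n)
  let ?D = "derived_series br V n"
  have "{br x y |x y. x \<in> ?D \<and> y \<in> ?D} = {br' x y |x y. x \<in> ?D \<and> y \<in> ?D}"
    using Suc eq by (metis subsetD)
  moreover have "bracket_span br ?D ?D \<subseteq> V"
    by (rule bracket_span_least) (use Suc V in auto)
  ultimately show ?case using Suc by (simp add: bracket_span_def)
qed simp

lemma lie_solvable_subset: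
  assumes "lie_solvable V br" "U \<subseteq> V" "subspace U"
  shows "lie_solvable U br"
  using assms derived_series_mono[OF assms(2)] subspace_derived_series[OF assms(3)]
  unfolding lie_solvable_def by (metis real_vector.subspace_0 singletonD subset_singletonD equals0D)

locale lie_alg =
  fixes L :: "'a::real_vector set" and br :: "'a \<Rightarrow> 'a \<Rightarrow> 'a"
  assumes lie: "lie_algebra L br"
begin

lemma fin: "finite_dim_subspace L" using lie unfolding lie_algebra_def by blast
lemma sub [simp]: "subspace L" using fin finite_dim_subspace_subspace by blast
lemma zero_mem [simp]: "0 \<in> L" by (simp add: real_vector.subspace_0)
lemma add_mem [simp]: "x \<in> L \<Longrightarrow> y \<in> L \<Longrightarrow> x + y \<in> L" by (simp add: real_vector.subspace_add)
lemma diff_mem [simp]: "x \<in> L \<Longrightarrow> y \<in> L \<Longrightarrow> x - y \<in> L" by (simp add: real_vector.subspace_diff)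
lemma minus_mem [simp]: "x \<in> L \<Longrightarrow> - x \<in> L" by (simp add: real_vector.subspace_neg)
lemma scale_mem [simp]: "x \<in> L \<Longrightarrow> c *\<^sub>R x \<in> L" by (simp add: real_vector.subspace_scale)
lemma sum_mem [simp]: "(\<And>i. i \<in> I \<Longrightarrow> f i \<in> L) \<Longrightarrow> sum f I \<in> L"
  by (rule real_vector.subspace_sum) auto
lemma br_mem [simp]: "x \<in> L \<Longrightarrow> y \<in> L \<Longrightarrow> br x y \<in> L"
  using lie unfolding lie_algebra_def by blast

lemma bilin: "bilinear_on L br" using lie unfolding lie_algebra_def by blast

lemma br_add_right [simp]: "x \<in> L \<Longrightarrow> y \<in> L \<Longrightarrow> z \<in> L \<Longrightarrow> br x (y + z) = br x y + br x z"
  and br_add_left [simp]: "x \<in> L \<Longrightarrow> y \<in> L \<Longrightarrow> z \<in> L \<Longrightarrow> br (x + y) z = br x z + br y z"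
  and br_scale_right [simp]: "x \<in> L \<Longrightarrow> y \<in> L \<Longrightarrow> br x (c *\<^sub>R y) = c *\<^sub>R br x y"
  and br_scale_left [simp]: "x \<in> L \<Longrightarrow> y \<in> L \<Longrightarrow> br (c *\<^sub>R x) y = c *\<^sub>R br x y"
  using bilin unfolding bilinear_on_def linear_on_def by blast+

lemma br_zero_right [simp]: "x \<in> L \<Longrightarrow> br x 0 = 0"
  using br_scale_right[of x 0 0] by simp
lemma br_zero_left [simp]: "x \<in> L \<Longrightarrow> br 0 x = 0"
  using br_scale_left[of 0 x 0] by simp
lemma br_minus_right [simp]: "x \<in> L \<Longrightarrow> y \<in> L \<Longrightarrow> br x (- y) = - br x y"
  using br_scale_right[of x y "-1"] by simp
lemma br_minus_left [simp]: "x \<in> L \<Longrightarrow> y \<in> L \<Longrightarrow> br (- x) y = - br x y"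
  using br_scale_left[of x y "-1"] by simp
lemma br_diff_right [simp]: "x \<in> L \<Longrightarrow> y \<in> L \<Longrightarrow> z \<in> L \<Longrightarrow> br x (y - z) = br x y - br x z"
  using br_add_right[of x y "-z"] by simp
lemma br_sum_right: "x \<in> L \<Longrightarrow> (\<And>i. i \<in> I \<Longrightarrow> f i \<in> L) \<Longrightarrow> br x (sum f I) = (\<Sum>i\<in>I. br x (f i))"
  by (induction I rule: infinite_finite_induct) auto

lemma br_self [simp]: "x \<in> L \<Longrightarrow> br x x = 0"
  using lie unfolding lie_algebra_def by blast

lemma br_anti: assumes "x \<in> L" "y \<in> L" shows "br y x = - br x y"
proof -
  have "0 = br (x + y) (x + y)" using assms by (intro br_self[symmetric]) simp
  also have "\<dots> = br x y + br y x" using assms by (simp del: br_self add: br_self[of x] br_self[of y])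
  finally have "br x y + br y x = 0" by simp
  then show ?thesis by (simp add: eq_neg_iff_add_eq_0 add.commute)
qed

lemma jacobi:
  assumes "x \<in> L" "y \<in> L" "z \<in> L"
  shows "br x (br y z) = br (br x y) z + br y (br x z)"
proof -
  have "br x (br y z) + br y (br z x) + br z (br x y) = 0"
    using lie assms unfolding lie_algebra_def by blast
  moreover have "br y (br z x) = - br y (br x z)" "br z (br x y) = - br (br x y) z"
    using assms br_anti[of x z] br_anti[of "br x y" z] by simp_all
  ultimately show ?thesis by (simp add: algebra_simps eq_neg_iff_add_eq_0)
qed

lemma lie_subalgebra:
  assumes "subspace S" "S \<subseteq> L" "\<And>x y. x \<in> S \<Longrightarrow> y \<in> S \<Longrightarrow> br x y \<in> S"
  shows "lie_algebra S br"
proof -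
  have "br x (br y z) + br y (br z x) + br z (br x y) = 0" if "x \<in> L" "y \<in> L" "z \<in> L" for x y z
    using lie that unfolding lie_algebra_def by blast
  then show ?thesis
    using assms finite_dim_subspace_mono[OF fin assms(1,2)]
    unfolding lie_algebra_def bilinear_on_def linear_on_def
    by (auto simp: subset_iff)
qed

text \<open>The usual definition of a sandwich also asks for \<open>ad x \<circ> ad y \<circ> ad x = 0\<close>; over the reals this
  follows from \<open>(ad x)\<^sup>2 = 0\<close>.\<close>

definition sandwiches :: "'a set" where
  "sandwiches = {x \<in> L. \<forall>y\<in>L. br x (br x y) = 0}"

lemma sandwiches_subset: "sandwiches \<subseteq> L" unfolding sandwiches_def by blast

lemma sandwich_mem [simp]: "x \<in> sandwiches \<Longrightarrow> x \<in> L" unfolding sandwiches_def by blast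

lemma sandwich_square [simp]: "x \<in> sandwiches \<Longrightarrow> y \<in> L \<Longrightarrow> br x (br x y) = 0"
  unfolding sandwiches_def by blast

lemma zero_sandwich: "0 \<in> sandwiches" unfolding sandwiches_def by simp

text \<open>Write \<open>X = ad x\<close> and \<open>Y = ad y\<close>. As \<open>[x, [y, x]] = 0\<close>, the operators \<open>X\<close> and \<open>ad [y, x] = YX - XY\<close>
  commute. Multiplying out with \<open>X\<^sup>2 = 0\<close> leaves \<open>-XYX = XYX\<close>.\<close>

lemma sandwich_sandwich [simp]:
  assumes x: "x \<in> sandwiches" and y: "y \<in> L" and z: "z \<in> L"
  shows "br x (br y (br x z)) = 0"
proof -
  have xL: "x \<in> L" using x by simp
  have "br (br y x) (br x z) = br y (br x (br x z)) - br x (br y (br x z))"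
    using jacobi[of y x "br x z"] xL y z by simp
  then have a: "br (br y x) (br x z) = - br x (br y (br x z))"
    using x y z by simp
  have "br x (br y x) = 0" using br_anti[OF xL y] xL x y by simp
  then have b: "br x (br (br y x) z) = br (br y x) (br x z)"
    using jacobi[of x "br y x" z] xL y z by simp
  have "br x (br y (br x z)) = br x (br (br y x) z + br x (br y z))"
    using jacobi[of y x z] xL y z by simp
  also have "\<dots> = br x (br (br y x) z)" using x y z xL by simp
  also have "\<dots> = - br x (br y (br x z))" using a b by simp
  finally have "br x (br y (br x z)) + br x (br y (br x z)) = 0"
    by (simp only: eq_neg_iff_add_eq_0)
  then have "2 *\<^sub>R br x (br y (br x z)) = 0" by (simp only: scaleR_2)
  then show ?thesis by simp
qed

text \<open>In \<open>(XY - YX)\<^sup>2 = XYXY - XYYX - YXXY + YXYX\<close> every term contains one of the vanishing factors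
  \<open>XYX\<close>, \<open>YXY\<close>, \<open>X\<^sup>2\<close>, \<open>Y\<^sup>2\<close>.\<close>

lemma br_sandwich:
  assumes x: "x \<in> sandwiches" and y: "y \<in> sandwiches"
  shows "br x y \<in> sandwiches"
proof -
  have L: "x \<in> L" "y \<in> L" using x y by auto
  have e: "br (br x y) w = br x (br y w) - br y (br x w)" if "w \<in> L" for w
    using jacobi[of x y w] L that by simp
  have "br (br x y) (br (br x y) z) = 0" if z: "z \<in> L" for z
    using L z x y by (simp add: e)
  then show ?thesis unfolding sandwiches_def using L by simp
qed

end

section \<open>Sandwiches act nilpotently\<close>

context lie_alg
begin

text \<open>The span of all \<open>[d\<^sub>1, [d\<^sub>2, \<dots>, [d\<^sub>n, l]]]\<close> with \<open>d\<^sub>i \<in> D\<close>. The set \<open>D\<close> acts nilpotently when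
  this is zero for some \<open>n\<close>.\<close>

primrec iterated_action :: "'a set \<Rightarrow> nat \<Rightarrow> 'a set" where
  "iterated_action D 0 = L"
| "iterated_action D (Suc n) = bracket_span br D (iterated_action D n)"

lemma subspace_iterated_action [simp]: "subspace (iterated_action D n)"
  by (cases n) auto

lemma iterated_action_subset: "D \<subseteq> L \<Longrightarrow> iterated_action D n \<subseteq> L"
proof (induction n)
  case (Suc n)
  have "bracket_span br D (iterated_action D n) \<subseteq> L"
    by (rule bracket_span_least) (use Suc in \<open>auto simp: subset_iff\<close>)
  then show ?case by simp
qed simp

lemma iterated_action_mem: "D \<subseteq> L \<Longrightarrow> x \<in> iterated_action D n \<Longrightarrow> x \<in> L"
  using iterated_action_subset by blast

lemma iterated_action_Suc_subset:
  "D \<subseteq> L \<Longrightarrow> iterated_action D (Suc n) \<subseteq> iterated_action D n"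
proof (induction n)
  case 0
  then show ?case using iterated_action_subset[of D 1] by simp
next
  case (Suc n)
  then show ?case
    using bracket_span_mono[of D D "iterated_action D (Suc n)" "iterated_action D n" br] by simp
qed

lemma span_mem: "D \<subseteq> L \<Longrightarrow> x \<in> span D \<Longrightarrow> x \<in> L"
  using real_vector.span_minimal sub by blast

lemma br_span_iterated_action:
  assumes D: "D \<subseteq> L" and x: "x \<in> span D" and l: "l \<in> iterated_action D n"
  shows "br x l \<in> iterated_action D (Suc n)"
proof -
  have lL: "l \<in> L" using iterated_action_mem[OF D l] .
  have "x \<in> L \<and> br x l \<in> iterated_action D (Suc n)"
    using x
  proof (induction x rule: real_vector.span_induct_alt)
    case base
    then show ?case using lL by (simp add: real_vector.subspace_0)
  next
    case (step c x y)
    have "x \<in> L" using step D by blast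
    moreover have "br x l \<in> iterated_action D (Suc n)"
      using step(1) l by (simp add: bracket_spanI)
    ultimately show ?case
      using step lL by (simp add: real_vector.subspace_add real_vector.subspace_scale)
  qed
  then show ?thesis by blast
qed

lemma span_br_closed:
  assumes D: "D \<subseteq> L" and S: "subspace S" and c: "\<And>d d'. d \<in> D \<Longrightarrow> d' \<in> D' \<Longrightarrow> br d d' \<in> S"
    and D': "D' \<subseteq> L" and x: "x \<in> span D" and y: "y \<in> span D'"
  shows "br x y \<in> S"
proof -
  have 1: "y \<in> L \<and> br d y \<in> S" if "d \<in> D" for d
    using y
  proof (induction y rule: real_vector.span_induct_alt)
    case base
    then show ?case using that D S by (auto simp: real_vector.subspace_0 subset_iff)
  next
    case (step a x y)
    have "x \<in> L" "d \<in> L" using step that D D' by blast+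
    then show ?case using step c[OF that] S
      by (simp add: real_vector.subspace_add real_vector.subspace_scale)
  qed
  have yL: "y \<in> L" using span_mem[OF D' y] .
  have "x \<in> L \<and> br x y \<in> S"
    using x
  proof (induction x rule: real_vector.span_induct_alt)
    case base
    then show ?case using yL S by (simp add: real_vector.subspace_0)
  next
    case (step a x z)
    have "x \<in> L" using step D by blast
    then show ?case using step 1 S yL
      by (simp add: real_vector.subspace_add real_vector.subspace_scale)
  qed
  then show ?thesis by blast
qed

text \<open>Moving \<open>c\<close> to the right past a factor from \<open>D\<close> costs a commutator, which lies in the span of \<open>D\<close>
  again, so the number of factors from \<open>D\<close> does not drop.\<close>

lemma normalizer_preserves_iterated_action:
  assumes D: "D \<subseteq> L" and c: "c \<in> L" and n: "\<And>d. d \<in> D \<Longrightarrow> br d c \<in> span D"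
    and l: "l \<in> iterated_action D n"
  shows "br c l \<in> iterated_action D n"
  using l
proof (induction n arbitrary: l)
  case 0
  then show ?case using c by simp
next
  case (Suc n)
  let ?A = "iterated_action D n"
  let ?S = "{l \<in> L. br c l \<in> iterated_action D (Suc n)}"
  have sS: "subspace ?S"
    by (rule real_vector.subspaceI)
      (use c subspace_iterated_action[of D "Suc n"] in \<open>simp_all add: real_vector.subspace_0
        real_vector.subspace_add real_vector.subspace_scale del: iterated_action.simps\<close>)
  have "br d m \<in> ?S" if d: "d \<in> D" and m: "m \<in> ?A" for d m
  proof -
    have L: "d \<in> L" "m \<in> L" using d m D iterated_action_mem by blast+
    have "br c d = - br d c" using br_anti L c by blast
    then have "br c d \<in> span D" using n[OF d] by (simp add: real_vector.span_neg)
    then have "br (br c d) m \<in> iterated_action D (Suc n)"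
      using br_span_iterated_action D m by blast
    moreover have "br d (br c m) \<in> iterated_action D (Suc n)"
      using Suc.IH[OF m] d by (simp add: bracket_spanI)
    ultimately have "br c (br d m) \<in> iterated_action D (Suc n)"
      using jacobi[OF c L] real_vector.subspace_add[OF subspace_iterated_action] by metis
    then show ?thesis using L by simp
  qed
  then have "iterated_action D (Suc n) \<subseteq> ?S"
    using bracket_span_least[of D ?A br ?S] sS by simp
  then show ?case using Suc.prems by blast
qed

text \<open>In a long product of elements of \<open>D\<close> and copies of \<open>c\<close>, two adjacent copies of \<open>c\<close> annihilate each
  other because \<open>c\<close> is a sandwich. Hence at least every second factor comes from \<open>D\<close>, and products of
  length \<open>2 * k\<close> contain \<open>k\<close> of those.\<close>

lemma insert_sandwich_nilpotent:
  assumes D: "D \<subseteq> L" and c: "c \<in> sandwiches" and n: "\<And>d. d \<in> D \<Longrightarrow> br d c \<in> span D"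
    and D': "D' \<subseteq> span (insert c D)" and k: "iterated_action D k = {0}"
  shows "iterated_action D' (2 * k) = {0}"
proof -
  have cL: "c \<in> L" using c by simp
  note A_mem = iterated_action_mem[OF D]
  have cA: "br c l \<in> iterated_action D j" if "l \<in> iterated_action D j" for l j
    using normalizer_preserves_iterated_action[OF D cL n that] .
  have two: "br x (br y l) \<in> iterated_action D (Suc j)"
    if "x \<in> D'" "y \<in> D'" "l \<in> iterated_action D j" for x y l j
  proof -
    obtain a b where ab: "x - a *\<^sub>R c \<in> span D" "y - b *\<^sub>R c \<in> span D"
      using D' \<open>x \<in> D'\<close> \<open>y \<in> D'\<close> real_vector.span_breakdown_eq by (metis subsetD)
    define d e where "d = x - a *\<^sub>R c" and "e = y - b *\<^sub>R c"
    have de: "d \<in> span D" "e \<in> span D" "d \<in> L" "e \<in> L"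
      using ab span_mem[OF D] unfolding d_def e_def by auto
    have xy: "x = a *\<^sub>R c + d" "y = b *\<^sub>R c + e" unfolding d_def e_def by auto
    have lL: "l \<in> L" using A_mem that by blast
    have el: "br e l \<in> iterated_action D (Suc j)"
      using br_span_iterated_action[OF D de(2) that(3)] .
    have "br d (br c l) \<in> iterated_action D (Suc j)"
      using br_span_iterated_action[OF D de(1) cA[OF that(3)]] .
    moreover have "br c (br e l) \<in> iterated_action D (Suc j)" using cA[OF el] .
    moreover have "br d (br e l) \<in> iterated_action D (Suc j)"
      using br_span_iterated_action[OF D de(1) el] iterated_action_Suc_subset[OF D] by blast
    ultimately have "a *\<^sub>R br c (br e l) + b *\<^sub>R br d (br c l) + br d (br e l)
        \<in> iterated_action D (Suc j)"
      by (intro real_vector.subspace_add real_vector.subspace_scale subspace_iterated_action)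
    \<comment> \<open>the remaining term carries the factor \<open>[c, [c, l]] = 0\<close>\<close>
    moreover have "br x (br y l) = a *\<^sub>R br c (br e l) + b *\<^sub>R br d (br c l) + br d (br e l)"
      unfolding xy using cL lL de c by (simp add: algebra_simps)
    ultimately show ?thesis by simp
  qed
  have D'L: "D' \<subseteq> L"
    using D' D cL real_vector.span_minimal[of "insert c D" L] sub by blast
  have "iterated_action D' (2 * j) \<subseteq> iterated_action D j" for j
  proof (induction j)
    case (Suc j)
    let ?S = "{l \<in> L. \<forall>x\<in>D'. br x l \<in> iterated_action D (Suc j)}"
    have "subspace ?S"
      by (rule real_vector.subspaceI)
        (use D'L subspace_iterated_action[of D "Suc j"] in \<open>auto simp: real_vector.subspace_0
          real_vector.subspace_add real_vector.subspace_scale subset_iff simp del: iterated_action.simps\<close>)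
    moreover have "br y l \<in> ?S" if "y \<in> D'" "l \<in> iterated_action D' (2 * j)" for y l
      using two that Suc D'L iterated_action_mem[OF D'L that(2)] by auto
    ultimately have "iterated_action D' (Suc (2 * j)) \<subseteq> ?S"
      by (simp add: bracket_span_least)
    then have "iterated_action D' (Suc (Suc (2 * j))) \<subseteq> iterated_action D (Suc j)"
      using bracket_span_least[of D' "iterated_action D' (Suc (2 * j))" br
          "iterated_action D (Suc j)"] by auto
    then show ?case by simp
  qed simp
  from this[of k] k show ?thesis
    using real_vector.subspace_0[OF subspace_iterated_action, of D' "2 * k"] by auto
qed

text \<open>Otherwise, starting from a sandwich outside the span of \<open>D\<close>, one could bracket with elements of \<open>D\<close>
  indefinitely without ever entering that span; but \<open>k\<close> such brackets give zero.\<close>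

lemma exists_normalizing_sandwich:
  assumes D: "D \<subseteq> sandwiches" "D = sandwiches \<inter> span D" and k: "iterated_action D k = {0}"
    and ne: "D \<noteq> sandwiches"
  obtains c where "c \<in> sandwiches" "c \<notin> span D" "\<And>d. d \<in> D \<Longrightarrow> br d c \<in> span D"
proof (rule ccontr)
  assume "\<not> thesis"
  with that have step: "\<exists>d\<in>D. br d c \<notin> span D" if "c \<in> sandwiches - span D" for c
    using that by blast
  have "\<exists>c \<in> iterated_action D n. c \<in> sandwiches - span D" for n
  proof (induction n)
    case 0
    then show ?case using D ne sandwiches_subset by auto
  next
    case (Suc n)
    then obtain c where c: "c \<in> iterated_action D n" "c \<in> sandwiches - span D" by blast
    then obtain d where d: "d \<in> D" "br d c \<notin> span D" using step by blast
    have "br d c \<in> iterated_action D (Suc n)" using c d by (simp add: bracket_spanI)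
    moreover have "br d c \<in> sandwiches" using c d D(1) br_sandwich by blast
    ultimately show ?case using d(2) by blast
  qed
  from this[of k] show False using k real_vector.span_zero by auto
qed

text \<open>Among the subsets \<open>D\<close> with nilpotent action that are closed under the bracket, one whose span has
  maximal dimension contains every sandwich: a normalizing sandwich outside \<open>D\<close> could be added. The
  condition \<open>D = sandwiches \<inter> span D\<close> makes \<open>D\<close> recoverable from its span, so that comparing
  dimensions compares the sets.\<close>

lemma sandwiches_act_nilpotently: "\<exists>k. iterated_action sandwiches k = {0}"
proof -
  define good where "good D \<longleftrightarrow> D \<subseteq> sandwiches \<and> D = sandwiches \<inter> span D \<and>
    (\<forall>x\<in>D. \<forall>y\<in>D. br x y \<in> D) \<and> (\<exists>k. iterated_action D k = {0})" for D
  have "good {0}"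
  proof -
    have "iterated_action {0} 1 \<subseteq> {0}"
      using bracket_span_least[of "{0}" L br "{0}"] real_vector.subspace_single_0 by auto
    then have "iterated_action {0} 1 = {0}"
      using real_vector.subspace_0[OF subspace_iterated_action, of "{0}" 1] by auto
    then have "\<exists>k. iterated_action {0} k = {0}" by blast
    then show ?thesis unfolding good_def using zero_sandwich by auto
  qed
  have dimb: "dim D \<le> dim L" if "good D" for D
    using that sandwiches_subset unfolding good_def by (intro dim_le_of_subset[OF fin]) blast
  obtain D where D: "good D" and max: "\<And>E. good E \<Longrightarrow> dim E \<le> dim D"
    using ex_has_greatest_nat[of good "{0}" dim "Suc (dim L)"] \<open>good {0}\<close> dimb
    by (metis le_imp_less_Suc)
  have DL: "D \<subseteq> L" and Ds: "D \<subseteq> sandwiches" "D = sandwiches \<inter> span D"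
    and Dbr: "\<And>x y. x \<in> D \<Longrightarrow> y \<in> D \<Longrightarrow> br x y \<in> D"
    using D sandwiches_subset unfolding good_def by blast+
  obtain k where k: "iterated_action D k = {0}" using D unfolding good_def by blast
  have "D = sandwiches"
  proof (rule ccontr)
    assume "D \<noteq> sandwiches"
    then obtain c where c: "c \<in> sandwiches" "c \<notin> span D" "\<And>d. d \<in> D \<Longrightarrow> br d c \<in> span D"
      using exists_normalizing_sandwich[OF Ds k] by blast
    define E where "E = sandwiches \<inter> span (insert c D)"
    have cL: "c \<in> L" using c by simp
    have cDL: "insert c D \<subseteq> L" using cL DL by simp
    have DE: "insert c D \<subseteq> E"
      unfolding E_def using Ds c(1) by (auto intro: real_vector.span_base)
    have sE: "span E = span (insert c D)"
    proof
      show "span E \<subseteq> span (insert c D)"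
        unfolding E_def by (rule real_vector.span_minimal) auto
      show "span (insert c D) \<subseteq> span E" using DE by (rule real_vector.span_mono)
    qed
    have gen: "br d d' \<in> span D" if "d \<in> insert c D" "d' \<in> insert c D" for d d'
    proof -
      have "br c e \<in> span D" if "e \<in> D" for e
        using c(3)[OF that] br_anti[of e c] that DL cL
        by (metis real_vector.span_neg subsetD)
      then show ?thesis
        using that c Dbr cL by (auto intro: real_vector.span_base simp: real_vector.span_zero)
    qed
    have "br x y \<in> span D" if "x \<in> E" "y \<in> E" for x y
      using span_br_closed[OF cDL real_vector.subspace_span gen cDL] that E_def by blast
    then have "\<forall>x\<in>E. \<forall>y\<in>E. br x y \<in> E"
      using br_sandwich real_vector.span_mono[of D "insert c D"] unfolding E_def by blast
    moreover have "iterated_action E (2 * k) = {0}"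
      by (rule insert_sandwich_nilpotent[OF DL c(1,3) _ k]) (auto simp: E_def)
    ultimately have "good E" unfolding good_def using sE by (auto simp: E_def)
    then have "dim (span E) \<le> dim (span D)" using max by simp
    moreover have "finite_dim_subspace (span E)"
      using real_vector.span_minimal[OF cDL] sE by (intro finite_dim_subspace_mono[OF fin]) auto
    moreover have "span D \<subseteq> span E" using sE real_vector.span_mono[of D "insert c D"] by auto
    ultimately have "span D = span E" using subspace_eq_of_dim_le by blast
    then show False using c(2) DE real_vector.span_base by blast
  qed
  with k show ?thesis by blast
qed

end

section \<open>Convergence in coordinates\<close>

lemma linear_on_sum:
  assumes f: "linear_on V f" and V: "subspace V" and v: "\<And>i. i \<in> I \<Longrightarrow> v i \<in> V"
  shows "f (\<Sum>i\<in>I. c i *\<^sub>R v i) = (\<Sum>i\<in>I. c i *\<^sub>R f (v i))"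
proof -
  have f0: "f 0 = 0"
    using f real_vector.subspace_0[OF V] unfolding linear_on_def by (metis scaleR_zero_left)
  have "(\<Sum>i\<in>I. c i *\<^sub>R v i) \<in> V \<and> ?thesis"
    using v
  proof (induction I rule: infinite_finite_induct)
    case (insert i I)
    then have "v i \<in> V" "c i *\<^sub>R v i \<in> V" "(\<Sum>i\<in>I. c i *\<^sub>R v i) \<in> V"
      using real_vector.subspace_scale[OF V] by auto
    then show ?case
      using insert f real_vector.subspace_add[OF V] unfolding linear_on_def by simp
  qed (use f0 real_vector.subspace_0[OF V] in auto)
  then show ?thesis by blast
qed

lemma coordinate_functionals:
  assumes "finite_dim_subspace V"
  obtains B and r :: "'a::real_vector \<Rightarrow> 'a \<Rightarrow> real"
  where "finite B" "B \<subseteq> V" "\<And>b. linear (r b)" "\<And>v. v \<in> V \<Longrightarrow> v = (\<Sum>b\<in>B. r b v *\<^sub>R b)"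
proof -
  obtain B where B: "finite B" "independent B" "span B = V"
    using finite_dim_subspace_basis[OF assms] .
  have "\<exists>f::'a \<Rightarrow> real. linear f \<and> (\<forall>x\<in>B. f x = (if x = b then 1 else 0))" for b
    using linear_independent_extend[OF B(2)] .
  then obtain r :: "'a \<Rightarrow> 'a \<Rightarrow> real"
    where r: "\<And>b. linear (r b)" "\<And>b x. x \<in> B \<Longrightarrow> r b x = (if x = b then 1 else 0)"
    by metis
  have "v = (\<Sum>b\<in>B. r b v *\<^sub>R b)" if "v \<in> V" for v
    using that unfolding B(3)[symmetric]
  proof (induction v rule: real_vector.span_induct_alt)
    case base
    then show ?case using linear_0[OF r(1)] by simp
  next
    case (step c x y)
    have "(\<Sum>b\<in>B. r b x *\<^sub>R b) = (\<Sum>b\<in>B. if b = x then x else 0)"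
      using r(2)[OF step(1)] by (intro sum.cong) auto
    also have "\<dots> = x" using B(1) step(1) by simp
    finally have x: "(\<Sum>b\<in>B. r b x *\<^sub>R b) = x" .
    have "(\<Sum>b\<in>B. r b (c *\<^sub>R x + y) *\<^sub>R b)
        = c *\<^sub>R (\<Sum>b\<in>B. r b x *\<^sub>R b) + (\<Sum>b\<in>B. r b y *\<^sub>R b)"
      by (simp add: linear_add[OF r(1)] linear_scale[OF r(1)] scaleR_add_left sum.distrib
          scaleR_sum_right)
    then show ?case using x step(2) by simp
  qed
  then show ?thesis using that[of B r] B r(1) real_vector.span_superset by blast
qed

text \<open>The ambient type has no topology. A series in a finite-dimensional carrier is therefore summed
  coordinatewise, and what convergence has to provide is expressed by testing against linear and
  bilinear functionals; for the latter the value at the limit is given by the Cauchy product.\<close>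

lemma sum_of_abs_summable_coordinates:
  fixes r :: "'a::real_vector \<Rightarrow> 'a \<Rightarrow> real" and e :: "nat \<Rightarrow> 'a"
  assumes V: "subspace V" and B: "finite B" "B \<subseteq> V"
    and r: "\<And>v. v \<in> V \<Longrightarrow> v = (\<Sum>b\<in>B. r b v *\<^sub>R b)"
    and e: "\<And>n. e n \<in> V" and s: "\<And>b. b \<in> B \<Longrightarrow> summable (\<lambda>n. \<bar>r b (e n)\<bar>)"
  obtains u where "u \<in> V"
    "\<And>f::'a \<Rightarrow> real. linear_on V f \<Longrightarrow> (\<lambda>n. f (e n)) sums f u"
    "\<And>\<beta>::'a \<Rightarrow> 'a \<Rightarrow> real. bilinear_on V \<beta> \<Longrightarrow> (\<lambda>n. \<Sum>i\<le>n. \<beta> (e i) (e (n - i))) sums \<beta> u u"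
proof -
  define s where "s b = (\<Sum>n. r b (e n))" for b
  define u where "u = (\<Sum>b\<in>B. s b *\<^sub>R b)"
  have BV: "b \<in> V" if "b \<in> B" for b using that B by blast
  have uV: "u \<in> V"
    unfolding u_def using V BV by (intro real_vector.subspace_sum real_vector.subspace_scale)
  have expand: "f v = (\<Sum>b\<in>B. r b v * f b)" if "linear_on V f" "v \<in> V" for f :: "'a \<Rightarrow> real" and v
    using linear_on_sum[OF that(1) V BV, of B "\<lambda>b. b" "\<lambda>b. r b v"] r[OF that(2)] by simp
  have expand_u: "f u = (\<Sum>b\<in>B. s b * f b)" if "linear_on V f" for f :: "'a \<Rightarrow> real"
    using linear_on_sum[OF that V BV, of B "\<lambda>b. b" s] unfolding u_def by simp
  have "(\<lambda>n. f (e n)) sums f u" if f: "linear_on V f" for f :: "'a \<Rightarrow> real"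
  proof -
    have "(\<lambda>n. \<Sum>b\<in>B. r b (e n) * f b) sums (\<Sum>b\<in>B. s b * f b)"
      unfolding s_def using s
      by (intro sums_sum sums_mult2 summable_sums) (auto intro: summable_rabs_cancel)
    then show ?thesis using expand[OF f e] expand_u[OF f] by simp
  qed
  moreover have "(\<lambda>n. \<Sum>i\<le>n. \<beta> (e i) (e (n - i))) sums \<beta> u u"
    if \<beta>: "bilinear_on V \<beta>" for \<beta> :: "'a \<Rightarrow> 'a \<Rightarrow> real"
  proof -
    have l: "linear_on V (\<beta> x)" "linear_on V (\<lambda>y. \<beta> y x)" if "x \<in> V" for x
      using \<beta> that unfolding bilinear_on_def by blast+
    have \<beta>e: "\<beta> x y = (\<Sum>b\<in>B. \<Sum>b'\<in>B. (r b x * r b' y) * \<beta> b b')" if "x \<in> V" "y \<in> V" for x y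
      using expand[OF l(2)[OF that(2)] that(1)] expand[OF l(1)[OF BV] that(2)]
      by (simp add: sum_distrib_left mult.assoc)
    have \<beta>u: "\<beta> u u = (\<Sum>b\<in>B. \<Sum>b'\<in>B. (s b * s b') * \<beta> b b')"
      using expand_u[OF l(2)[OF uV]] expand_u[OF l(1)[OF BV]]
      by (simp add: sum_distrib_left mult.assoc)
    have "(\<lambda>n. \<Sum>b\<in>B. \<Sum>b'\<in>B. (\<Sum>i\<le>n. r b (e i) * r b' (e (n - i))) * \<beta> b b') sums \<beta> u u"
      unfolding \<beta>u s_def using s
      by (intro sums_sum sums_mult2 Cauchy_product_sums) auto
    moreover have "(\<Sum>b\<in>B. \<Sum>b'\<in>B. (\<Sum>i\<le>n. r b (e i) * r b' (e (n - i))) * \<beta> b b')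
        = (\<Sum>i\<le>n. \<beta> (e i) (e (n - i)))" for n
    proof -
      have "(\<Sum>i\<le>n. \<beta> (e i) (e (n - i)))
          = (\<Sum>i\<le>n. \<Sum>b\<in>B. \<Sum>b'\<in>B. (r b (e i) * r b' (e (n - i))) * \<beta> b b')"
        using \<beta>e[OF e e] by simp
      also have "\<dots> = (\<Sum>b\<in>B. \<Sum>i\<le>n. \<Sum>b'\<in>B. (r b (e i) * r b' (e (n - i))) * \<beta> b b')"
        by (rule sum.swap)
      also have "\<dots> = (\<Sum>b\<in>B. \<Sum>b'\<in>B. \<Sum>i\<le>n. (r b (e i) * r b' (e (n - i))) * \<beta> b b')"
        by (intro sum.cong refl sum.swap)
      finally show ?thesis by (simp add: sum_distrib_right)
    qed
    ultimately show ?thesis by simp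
  qed
  ultimately show ?thesis using that uV by blast
qed

section \<open>The exponential of an inner derivation\<close>

context lie_alg
begin

text \<open>The terms \<open>(ad y)\<^sup>n x / n!\<close> of the exponential series of \<open>ad y\<close> at \<open>x\<close>.\<close>

primrec exp_term :: "'a \<Rightarrow> 'a \<Rightarrow> nat \<Rightarrow> 'a" where
  "exp_term y x 0 = x"
| "exp_term y x (Suc n) = (1 / real (Suc n)) *\<^sub>R br y (exp_term y x n)"

lemma exp_term_mem [simp]: "y \<in> L \<Longrightarrow> x \<in> L \<Longrightarrow> exp_term y x n \<in> L"
  by (induction n) auto

lemma br_exp_term: "br y (exp_term y x n) = real (Suc n) *\<^sub>R exp_term y x (Suc n)"
  by (simp del: of_nat_Suc)

lemma exp_term_scale:
  assumes "y \<in> L" "x \<in> L" shows "exp_term (t *\<^sub>R y) x n = t ^ n *\<^sub>R exp_term y x n"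
proof (induction n)
  case (Suc n)
  have "exp_term y x n \<in> L" using assms by simp
  then show ?case using Suc assms by (simp add: mult_ac)
qed simp

text \<open>The sum is the degree-\<open>m\<close> part of \<open>(ad (exp (ad y) x))\<^sup>2 w\<close>. Denote it by \<open>S\<^sub>m w\<close>. The derivation
  property of \<open>ad y\<close> gives \<open>(m + 1) S\<^sub>m\<^sub>+\<^sub>1 w = [y, S\<^sub>m w] - S\<^sub>m [y, w]\<close>, and \<open>S\<^sub>0 = 0\<close> says that
  \<open>x\<close> is a sandwich.\<close>

lemma exp_sandwich_square:
  assumes x: "x \<in> sandwiches" and y: "y \<in> L" and w: "w \<in> L"
  shows "(\<Sum>i\<le>m. br (exp_term y x i) (br (exp_term y x (m - i)) w)) = 0"
  using w
proof (induction m arbitrary: w)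
  case 0
  then show ?case using x by simp
next
  case (Suc m)
  define e where "e = exp_term y x"
  define T where "T i j = br (e i) (br (e j) w)" for i j
  have eL: "e i \<in> L" for i unfolding e_def using x y by simp
  have TL: "T i j \<in> L" for i j unfolding T_def using eL Suc.prems by simp
  have ye: "br y (e i) = real (Suc i) *\<^sub>R e (Suc i)" for i
    unfolding e_def by (rule br_exp_term)
  have leibniz: "br y (T i j) - br (e i) (br (e j) (br y w))
      = real (Suc i) *\<^sub>R T (Suc i) j + real (Suc j) *\<^sub>R T i (Suc j)" for i j
    unfolding T_def using eL y Suc.prems jacobi[of y "e i" "br (e j) w"] jacobi[of y "e j" w]
    by (simp add: ye del: of_nat_Suc)
  have "0 = br y (\<Sum>i\<le>m. T i (m - i)) - (\<Sum>i\<le>m. br (e i) (br (e (m - i)) (br y w)))"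
    using Suc.IH[OF Suc.prems] Suc.IH[of "br y w"] Suc.prems y unfolding T_def e_def by simp
  also have "\<dots> = (\<Sum>i\<le>m. br y (T i (m - i)) - br (e i) (br (e (m - i)) (br y w)))"
    using br_sum_right[OF y, of "{..m}" "\<lambda>i. T i (m - i)"] TL by (simp add: sum_subtractf)
  also have "\<dots> = (\<Sum>i\<le>m. real (Suc i) *\<^sub>R T (Suc i) (m - i))
      + (\<Sum>i\<le>m. real (Suc (m - i)) *\<^sub>R T i (Suc (m - i)))"
    unfolding leibniz by (rule sum.distrib)
  also have "(\<Sum>i\<le>m. real (Suc i) *\<^sub>R T (Suc i) (m - i)) = (\<Sum>i\<le>Suc m. real i *\<^sub>R T i (Suc m - i))"
    by (simp add: sum.atMost_Suc_shift del: sum.atMost_Suc of_nat_Suc)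
  also have "(\<Sum>i\<le>m. real (Suc (m - i)) *\<^sub>R T i (Suc (m - i)))
      = (\<Sum>i\<le>Suc m. real (Suc m - i) *\<^sub>R T i (Suc m - i))"
  proof -
    have "(\<Sum>i\<le>m. real (Suc (m - i)) *\<^sub>R T i (Suc (m - i)))
        = (\<Sum>i\<le>m. real (Suc m - i) *\<^sub>R T i (Suc m - i))"
      by (intro sum.cong refl) (simp only: Suc_diff_le atMost_iff)
    then show ?thesis by (simp only: sum.atMost_Suc diff_self_eq_0 of_nat_0 scaleR_zero_left add_0_right)
  qed
  also have "(\<Sum>i\<le>Suc m. real i *\<^sub>R T i (Suc m - i)) + (\<Sum>i\<le>Suc m. real (Suc m - i) *\<^sub>R T i (Suc m - i))
      = (\<Sum>i\<le>Suc m. real (Suc m) *\<^sub>R T i (Suc m - i))"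
    unfolding sum.distrib[symmetric] scaleR_add_left[symmetric] of_nat_add[symmetric]
    by (intro sum.cong) auto
  also have "\<dots> = real (Suc m) *\<^sub>R (\<Sum>i\<le>Suc m. T i (Suc m - i))"
    by (simp only: scaleR_sum_right)
  finally have "(\<Sum>i\<le>Suc m. T i (Suc m - i)) = 0"
    by (simp del: sum.atMost_Suc of_nat_Suc)
  then show ?case unfolding T_def e_def .
qed

text \<open>The operator \<open>ad y\<close> is bounded for the \<open>l\<^sup>1\<close> norm of the coordinates, so the exponential series is
  dominated coordinatewise by that of a real number. The witness is \<open>u = exp (ad y) x\<close>.\<close>

lemma exp_ad_exists:
  assumes y: "y \<in> L" and x: "x \<in> L"
  obtains u where "u \<in> L"
    "\<And>f::'a \<Rightarrow> real. linear_on L f \<Longrightarrow> (\<lambda>n. f (exp_term y x n)) sums f u"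
    "\<And>\<beta>::'a \<Rightarrow> 'a \<Rightarrow> real. bilinear_on L \<beta> \<Longrightarrow>
      (\<lambda>n. \<Sum>i\<le>n. \<beta> (exp_term y x i) (exp_term y x (n - i))) sums \<beta> u u"
proof -
  obtain B and r :: "'a \<Rightarrow> 'a \<Rightarrow> real" where B: "finite B" "B \<subseteq> L"
    and r: "\<And>b. linear (r b)" "\<And>v. v \<in> L \<Longrightarrow> v = (\<Sum>b\<in>B. r b v *\<^sub>R b)"
    using coordinate_functionals[OF fin] by metis
  define N where "N v = (\<Sum>b\<in>B. \<bar>r b v\<bar>)" for v
  define M where "M = (\<Sum>b\<in>B. N (br y b))"
  have N0: "0 \<le> N v" for v unfolding N_def by (simp add: sum_nonneg)
  have bound: "N (br y v) \<le> M * N v" if v: "v \<in> L" for v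
  proof -
    have "br y v = br y (\<Sum>b\<in>B. r b v *\<^sub>R b)" using r(2)[OF v] by simp
    also have "\<dots> = (\<Sum>b\<in>B. r b v *\<^sub>R br y b)"
      using y B(2) by (subst br_sum_right) (auto simp: subset_iff)
    finally have "N (br y v) = (\<Sum>b'\<in>B. \<bar>\<Sum>b\<in>B. r b v * r b' (br y b)\<bar>)"
      unfolding N_def by (simp add: linear_sum[OF r(1)] linear_scale[OF r(1)])
    also have "\<dots> \<le> (\<Sum>b'\<in>B. \<Sum>b\<in>B. \<bar>r b v\<bar> * \<bar>r b' (br y b)\<bar>)"
      by (intro sum_mono order_trans[OF sum_abs]) (simp add: abs_mult)
    also have "\<dots> = (\<Sum>b\<in>B. \<bar>r b v\<bar> * N (br y b))"
      unfolding N_def by (subst sum.swap) (simp add: sum_distrib_left)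
    also have "\<dots> \<le> (\<Sum>b\<in>B. \<bar>r b v\<bar> * M)"
      unfolding M_def using B(1) N0 by (intro sum_mono mult_left_mono member_le_sum) auto
    also have "\<dots> = M * N v" unfolding N_def by (simp add: sum_distrib_left mult.commute)
    finally show ?thesis .
  qed
  have growth: "N (exp_term y x n) \<le> N x * (inverse (fact n) * M ^ n)" for n
  proof (induction n)
    case (Suc n)
    have M0: "0 \<le> M" unfolding M_def using N0 by (simp add: sum_nonneg)
    have "N (exp_term y x (Suc n)) = (1 / real (Suc n)) * N (br y (exp_term y x n))"
      unfolding N_def exp_term.simps linear_scale[OF r(1)]
      by (simp add: abs_mult sum_distrib_left)
    also have "\<dots> \<le> (1 / real (Suc n)) * (M * (N x * (inverse (fact n) * M ^ n)))"
      using bound[of "exp_term y x n"] y x mult_left_mono[OF Suc M0]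
      by (intro mult_left_mono) auto
    also have "\<dots> = N x * (inverse (fact (Suc n)) * M ^ Suc n)"
      by (simp add: field_simps)
    finally show ?case .
  qed simp
  have "summable (\<lambda>n. \<bar>r b (exp_term y x n)\<bar>)" if b: "b \<in> B" for b
  proof (rule summable_comparison_test')
    show "summable (\<lambda>n. N x * (inverse (fact n) * M ^ n))"
      by (intro summable_mult summable_exp)
    show "norm \<bar>r b (exp_term y x n)\<bar> \<le> N x * (inverse (fact n) * M ^ n)" if "n \<ge> 0" for n
      using growth[of n] member_le_sum[OF b, of "\<lambda>b. \<bar>r b (exp_term y x n)\<bar>"] B(1)
      unfolding N_def by simp
  qed
  then show ?thesis
    using sum_of_abs_summable_coordinates[OF sub B r(2), of "exp_term y x"] y x that by auto
qed

text \<open>Every linear functional takes \<open>[u, [u, w]]\<close> to a Cauchy product all of whose terms vanish by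
  \<open>exp_sandwich_square\<close>.\<close>

lemma exp_ad_sandwich:
  assumes x: "x \<in> sandwiches" and y: "y \<in> L"
  obtains u where "u \<in> sandwiches"
    "\<And>f::'a \<Rightarrow> real. linear_on L f \<Longrightarrow> (\<lambda>n. f (exp_term y x n)) sums f u"
proof -
  obtain u where u: "u \<in> L"
    "\<And>f::'a \<Rightarrow> real. linear_on L f \<Longrightarrow> (\<lambda>n. f (exp_term y x n)) sums f u"
    "\<And>\<beta>::'a \<Rightarrow> 'a \<Rightarrow> real. bilinear_on L \<beta> \<Longrightarrow>
      (\<lambda>n. \<Sum>i\<le>n. \<beta> (exp_term y x i) (exp_term y x (n - i))) sums \<beta> u u"
    using exp_ad_exists[OF y, of x] x by auto
  have "br u (br u w) = 0" if w: "w \<in> L" for w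
  proof (rule ccontr)
    assume ne: "br u (br u w) \<noteq> 0"
    obtain f :: "'a \<Rightarrow> real" where f: "linear f" "f (br u (br u w)) = 1"
      using exists_linear_separating[of "{0}" "br u (br u w)"] ne by auto
    have "bilinear_on L (\<lambda>a b. f (br a (br b w)))"
      unfolding bilinear_on_def linear_on_def using w
      by (simp add: linear_add[OF f(1)] linear_scale[OF f(1)])
    from u(3)[OF this]
    have "(\<lambda>n. f (\<Sum>i\<le>n. br (exp_term y x i) (br (exp_term y x (n - i)) w))) sums f (br u (br u w))"
      by (simp add: linear_sum[OF f(1)])
    then have "(\<lambda>n. 0) sums f (br u (br u w))"
      using exp_sandwich_square[OF x y w] linear_0[OF f(1)] by simp
    then show False using f(2) sums_unique2[OF sums_zero] by fastforce
  qed
  then have "u \<in> sandwiches" unfolding sandwiches_def using u(1) by blast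
  then show ?thesis using that u(2) by blast
qed

text \<open>If a linear functional \<open>f\<close> vanishes on all sandwiches, the power series \<open>f (exp (t ad y) x)\<close> is zero
  for every \<open>t\<close>. Its linear coefficient \<open>f [y, x]\<close> is then zero too.\<close>

lemma br_sandwich_in_span:
  assumes y: "y \<in> L" and x: "x \<in> sandwiches"
  shows "br y x \<in> span sandwiches"
proof (rule ccontr)
  assume "br y x \<notin> span sandwiches"
  then obtain f :: "'a \<Rightarrow> real" where f: "linear f" "\<And>v. v \<in> span sandwiches \<Longrightarrow> f v = 0" "f (br y x) = 1"
    using exists_linear_separating[OF real_vector.subspace_span] by metis
  have fL: "linear_on L f"
    unfolding linear_on_def by (simp add: linear_add[OF f(1)] linear_scale[OF f(1)])
  define a where "a n = f (exp_term y x n)" for n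
  have "(\<lambda>n. a (Suc n) * t ^ n) sums 0" if t: "t \<noteq> 0" for t
  proof -
    obtain u where u: "u \<in> sandwiches" "(\<lambda>n. f (exp_term (t *\<^sub>R y) x n)) sums f u"
      using exp_ad_sandwich[OF x, of "t *\<^sub>R y"] y fL by auto
    have "f u = 0" using u(1) f(2) real_vector.span_base by blast
    moreover have "f (exp_term (t *\<^sub>R y) x n) = a n * t ^ n" for n
      using exp_term_scale[OF y, of x t n] x unfolding a_def
      by (simp add: linear_scale[OF f(1)] mult.commute)
    ultimately have "(\<lambda>n. a n * t ^ n) sums 0" using u(2) by simp
    moreover have "a 0 = 0" unfolding a_def using f(2) x real_vector.span_base by auto
    ultimately have "(\<lambda>n. a (Suc n) * t ^ Suc n) sums 0"
      by (subst sums_Suc_iff) simp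
    then have "(\<lambda>n. (a (Suc n) * t ^ Suc n) / t) sums (0 / t)" by (rule sums_divide)
    then show ?thesis using t by simp
  qed
  then have "((\<lambda>t::real. 0) \<longlongrightarrow> a 1) (at 0)"
    using powser_limit_0_strong[of 1 "\<lambda>n. a (Suc n)" "\<lambda>t. 0"] by simp
  from LIM_const_eq[OF this] have "a 1 = 0" by simp
  then show False using f(3) unfolding a_def by simp
qed

text \<open>The span of the sandwiches is an ideal, and its derived series sinks through the iterated
  actions of the sandwiches, which reach zero. So it is a solvable ideal.\<close>

theorem semisimple_sandwich_zero:
  assumes "lie_semisimple L br" and x: "x \<in> L" "\<And>y. y \<in> L \<Longrightarrow> br x (br x y) = 0"
  shows "x = 0"
proof -
  let ?I = "span sandwiches"
  have IL: "?I \<subseteq> L" using span_mem[OF sandwiches_subset] by blast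
  have ideal: "br y z \<in> ?I" if "y \<in> L" "z \<in> ?I" for y z
    using span_br_closed[OF _ real_vector.subspace_span br_sandwich_in_span sandwiches_subset
        real_vector.span_base[OF that(1)] that(2)] by simp
  obtain k where k: "iterated_action sandwiches k = {0}"
    using sandwiches_act_nilpotently by blast
  have "derived_series br ?I n \<subseteq> iterated_action sandwiches n \<inter> ?I" for n
  proof (induction n)
    case (Suc n)
    let ?D = "derived_series br ?I n"
    have "bracket_span br ?D ?D \<subseteq> iterated_action sandwiches (Suc n) \<inter> ?I"
    proof (rule bracket_span_least)
      fix u v assume uv: "u \<in> ?D" "v \<in> ?D"
      then have "u \<in> ?I" "v \<in> iterated_action sandwiches n" "v \<in> ?I"
        using Suc by auto
      then show "br u v \<in> iterated_action sandwiches (Suc n) \<inter> ?I"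
        using br_span_iterated_action[OF sandwiches_subset] ideal[of u v] IL by auto
    next
      show "subspace (iterated_action sandwiches (Suc n) \<inter> ?I)"
        by (intro real_vector.subspace_inter) auto
    qed
    then show ?case by simp
  qed (use IL in simp)
  from this[of k] have "derived_series br ?I k \<subseteq> {0}" using k by simp
  moreover have "0 \<in> derived_series br ?I k"
    by (intro real_vector.subspace_0 subspace_derived_series real_vector.subspace_span)
  ultimately have "derived_series br ?I k = {0}" by auto
  then have "lie_solvable ?I br" unfolding lie_solvable_def by (rule exI)
  moreover have "lie_ideal ?I L br" unfolding lie_ideal_def using ideal IL by simp
  ultimately have "?I = {0}" using assms(1) unfolding lie_semisimple_def by blast
  moreover have "x \<in> sandwiches" unfolding sandwiches_def using x by blast
  then have "x \<in> ?I" by (rule real_vector.span_base)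
  ultimately show ?thesis by simp
qed

end

section \<open>Semisimple Lie algebras and direct sums\<close>

lemma lie_semisimpleD:
  "lie_semisimple V br \<Longrightarrow> lie_ideal I V br \<Longrightarrow> lie_solvable I br \<Longrightarrow> I = {0}"
  unfolding lie_semisimple_def by blast

text \<open>The last hypothesis says that each element of \<open>L\<close> acts on \<open>S\<close> as some element of \<open>S\<close> does, which
  holds when \<open>S\<close> is a direct factor of \<open>L\<close>. Ideals of \<open>S\<close> are then ideals of \<open>L\<close>. Two brackets occur
  because \<open>S\<close> may inherit its bracket from another algebra that also contains it.\<close>

lemma lie_semisimple_direct_factor:
  assumes ss: "lie_semisimple L br1"
    and S: "subspace S" "S \<subseteq> L" "\<And>x y. x \<in> S \<Longrightarrow> y \<in> S \<Longrightarrow> br2 x y \<in> S"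
    and eq: "\<And>x y. x \<in> S \<Longrightarrow> y \<in> S \<Longrightarrow> br1 x y = br2 x y"
    and complement: "\<And>x. x \<in> L \<Longrightarrow> \<exists>s\<in>S. \<forall>y\<in>S. br1 x y = br2 s y"
  shows "lie_semisimple S br2"
  unfolding lie_semisimple_def
proof (intro allI impI)
  fix I assume I: "lie_ideal I S br2 \<and> lie_solvable I br2"
  then have sI: "subspace I" "I \<subseteq> S" "\<And>x y. x \<in> S \<Longrightarrow> y \<in> I \<Longrightarrow> br2 x y \<in> I"
    unfolding lie_ideal_def by blast+
  have "derived_series br2 I n = derived_series br1 I n" for n
    using derived_series_cong[of I br2 br1] sI eq by (metis subsetD)
  then have "lie_solvable I br1" using I unfolding lie_solvable_def by simp
  moreover have "lie_ideal I L br1"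
    unfolding lie_ideal_def
  proof (intro conjI ballI sI)
    show "I \<subseteq> L" using sI(2) S(2) by blast
    fix x y assume x: "x \<in> L" and y: "y \<in> I"
    obtain s where "s \<in> S" "\<forall>y\<in>S. br1 x y = br2 s y" using complement[OF x] by blast
    then show "br1 x y \<in> I" using sI y by auto
  qed
  ultimately show "I = {0}" using lie_semisimpleD[OF ss] by blast
qed

text \<open>A solvable ideal \<open>I\<close> of the sum meets both summands in solvable ideals, hence trivially. For
  \<open>a + b \<in> I\<close> and \<open>x \<in> S\<close> the bracket \<open>[x, a + b] = [x, a]\<close> lies in \<open>I \<inter> S = 0\<close>, so \<open>a\<close> is central in
  \<open>S\<close>. The centre is an abelian ideal, so \<open>a = 0\<close>; likewise \<open>b = 0\<close>.\<close>

lemma (in lie_alg) lie_semisimple_sum: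
  assumes S: "subspace S" "S \<subseteq> L" "\<And>x y. x \<in> S \<Longrightarrow> y \<in> S \<Longrightarrow> br x y \<in> S" "lie_semisimple S br"
    and T: "subspace T" "T \<subseteq> L" "\<And>x y. x \<in> T \<Longrightarrow> y \<in> T \<Longrightarrow> br x y \<in> T" "lie_semisimple T br"
    and comm: "\<And>x y. x \<in> S \<Longrightarrow> y \<in> T \<Longrightarrow> br x y = 0"
  shows "lie_semisimple {x + y | x y. x \<in> S \<and> y \<in> T} br"
proof -
  let ?W = "{x + y | x y. x \<in> S \<and> y \<in> T}"
  have SL: "x \<in> L" if "x \<in> S" for x using that S by blast
  have TL: "x \<in> L" if "x \<in> T" for x using that T by blast
  have comm': "br y x = 0" if "x \<in> S" "y \<in> T" for x y
    using comm[OF that] br_anti[of x y] that SL TL by simp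
  have centre: "a = 0" if A: "lie_semisimple A br" "subspace A" "A \<subseteq> L"
    and a: "a \<in> A" "\<And>x. x \<in> A \<Longrightarrow> br x a = 0" for A a
  proof -
    let ?Z = "{z \<in> A. \<forall>x\<in>A. br x z = 0}"
    have AL: "x \<in> L" if "x \<in> A" for x using that A by blast
    have sZ: "subspace ?Z"
      by (rule real_vector.subspaceI)
        (use A(2) AL in \<open>auto simp: real_vector.subspace_0 real_vector.subspace_add
          real_vector.subspace_scale\<close>)
    have "derived_series br ?Z 1 = {0}"
    proof -
      have "bracket_span br ?Z ?Z \<subseteq> {0}"
        by (rule bracket_span_least) (auto simp: real_vector.subspace_single_0)
      moreover have "0 \<in> bracket_span br ?Z ?Z"
        by (intro real_vector.subspace_0 subspace_bracket_span)
      ultimately show ?thesis by auto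
    qed
    then have "lie_solvable ?Z br" unfolding lie_solvable_def by blast
    moreover have "lie_ideal ?Z A br"
      unfolding lie_ideal_def
      using sZ A(2) AL by (auto simp: real_vector.subspace_0)
    ultimately have "?Z = {0}" using lie_semisimpleD[OF A(1)] by blast
    moreover have "a \<in> ?Z" using a by blast
    ultimately show ?thesis by blast
  qed
  have meet: "I \<inter> A = {0}"
    if I: "lie_ideal I ?W br" "lie_solvable I br" and A: "lie_semisimple A br" "subspace A" "A \<subseteq> ?W"
      "\<And>x y. x \<in> A \<Longrightarrow> y \<in> A \<Longrightarrow> br x y \<in> A" for I A
  proof -
    have Iid: "subspace I" "\<And>x y. x \<in> ?W \<Longrightarrow> y \<in> I \<Longrightarrow> br x y \<in> I"
      using I(1) unfolding lie_ideal_def by simp_all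
    have sIA: "subspace (I \<inter> A)" using Iid(1) A(2) by (rule real_vector.subspace_inter)
    have solv: "lie_solvable (I \<inter> A) br"
      by (rule lie_solvable_subset[OF I(2) Int_lower1 sIA])
    have "br x y \<in> I \<inter> A" if x: "x \<in> A" and y: "y \<in> I \<inter> A" for x y
    proof (rule IntI)
      show "br x y \<in> I" by (rule Iid(2)) (use x y A(3) in auto)
      show "br x y \<in> A" by (rule A(4)) (use x y in auto)
    qed
    then have "lie_ideal (I \<inter> A) A br" unfolding lie_ideal_def using sIA by simp
    then show ?thesis using lie_semisimpleD[OF A(1)] solv by blast
  qed
  have SW: "S \<subseteq> ?W" using real_vector.subspace_0[OF T(1)] by force
  have TW: "T \<subseteq> ?W" using real_vector.subspace_0[OF S(1)] by force
  show ?thesis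
    unfolding lie_semisimple_def
  proof (intro allI impI)
    fix I assume I: "lie_ideal I ?W br \<and> lie_solvable I br"
    then have sI: "subspace I" "I \<subseteq> ?W" "\<And>x y. x \<in> ?W \<Longrightarrow> y \<in> I \<Longrightarrow> br x y \<in> I"
      unfolding lie_ideal_def by blast+
    have IS: "I \<inter> S = {0}" by (rule meet) (use I S SW in blast)+
    have IT: "I \<inter> T = {0}" by (rule meet) (use I T TW in blast)+
    have "z = 0" if z: "z \<in> I" for z
    proof -
      obtain a b where ab: "a \<in> S" "b \<in> T" "z = a + b" using z sI(2) by blast
      have "br x a = 0" if x: "x \<in> S" for x
      proof -
        have "br x z = br x a" using ab x SL TL comm by simp
        moreover have "br x z \<in> I" using sI(3) x z SW by blast
        ultimately have "br x a \<in> I \<inter> S" using S(3)[OF x ab(1)] by simp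
        then show ?thesis using IS by blast
      qed
      then have a0: "a = 0" using centre[OF S(4,1,2) ab(1)] by blast
      have "br y b = 0" if y: "y \<in> T" for y
      proof -
        have "br y z = br y b" using ab y SL TL comm' by simp
        moreover have "br y z \<in> I" using sI(3) y z TW by blast
        ultimately have "br y b \<in> I \<inter> T" using T(3)[OF y ab(2)] by simp
        then show ?thesis using IT by blast
      qed
      then have "b = 0" using centre[OF T(4,1,2) ab(2)] by blast
      with a0 ab show ?thesis by simp
    qed
    then show "I = {0}" using real_vector.subspace_0[OF sI(1)] by blast
  qed
qed

section \<open>Symplectic symmetric triples\<close>

lemma P_part_restrict [simp]:
  "S \<subseteq> carrier t \<Longrightarrow> P_part (t\<lparr>carrier := S\<rparr>) = P_part t \<inter> S"
  unfolding P_part_def by auto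

lemma K_part_restrict [simp]:
  "S \<subseteq> carrier t \<Longrightarrow> K_part (t\<lparr>carrier := S\<rparr>) = K_part t \<inter> S"
  unfolding K_part_def by auto

locale symp_triple =
  fixes t :: "'a::real_vector triple"
  assumes triple: "symplectic_symmetric_triple t"
begin

sublocale lie_alg "carrier t" "bracket t"
  using triple unfolding symplectic_symmetric_triple_def by unfold_locales blast

abbreviation "G \<equiv> carrier t"
abbreviation "br \<equiv> bracket t"
abbreviation "\<sigma> \<equiv> invol t"
abbreviation "\<Omega> \<equiv> form t"
abbreviation "K \<equiv> K_part t"
abbreviation "P \<equiv> P_part t"

lemma K_mem: "x \<in> K \<Longrightarrow> x \<in> G" and P_mem: "x \<in> P \<Longrightarrow> x \<in> G"
  unfolding K_part_def P_part_def by auto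

lemma invol_mem [simp]: "x \<in> G \<Longrightarrow> \<sigma> x \<in> G"
  and invol_add: "x \<in> G \<Longrightarrow> y \<in> G \<Longrightarrow> \<sigma> (x + y) = \<sigma> x + \<sigma> y"
  and invol_scale: "x \<in> G \<Longrightarrow> \<sigma> (c *\<^sub>R x) = c *\<^sub>R \<sigma> x"
  and invol_invol [simp]: "x \<in> G \<Longrightarrow> \<sigma> (\<sigma> x) = x"
  and invol_br: "x \<in> G \<Longrightarrow> y \<in> G \<Longrightarrow> \<sigma> (br x y) = br (\<sigma> x) (\<sigma> y)"
proof -
  have "involutive_automorphism G br \<sigma>"
    using triple unfolding symplectic_symmetric_triple_def by simp
  then have "\<forall>x\<in>G. \<sigma> x \<in> G" "\<forall>x\<in>G. \<forall>y\<in>G. \<sigma> (x + y) = \<sigma> x + \<sigma> y"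
    "\<forall>c. \<forall>x\<in>G. \<sigma> (c *\<^sub>R x) = c *\<^sub>R \<sigma> x" "\<forall>x\<in>G. \<sigma> (\<sigma> x) = x"
    "\<forall>x\<in>G. \<forall>y\<in>G. \<sigma> (br x y) = br (\<sigma> x) (\<sigma> y)"
    unfolding involutive_automorphism_def linear_on_def by - (elim conjE, assumption)+
  then show "x \<in> G \<Longrightarrow> \<sigma> x \<in> G"
    and "x \<in> G \<Longrightarrow> y \<in> G \<Longrightarrow> \<sigma> (x + y) = \<sigma> x + \<sigma> y"
    and "x \<in> G \<Longrightarrow> \<sigma> (c *\<^sub>R x) = c *\<^sub>R \<sigma> x"
    and "x \<in> G \<Longrightarrow> \<sigma> (\<sigma> x) = x"
    and "x \<in> G \<Longrightarrow> y \<in> G \<Longrightarrow> \<sigma> (br x y) = br (\<sigma> x) (\<sigma> y)" by simp_all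
qed

lemma invol_zero [simp]: "\<sigma> 0 = 0" using invol_scale[of 0 0] by simp

lemma subspace_K: "subspace K"
  unfolding K_part_def real_vector.subspace_def by (simp add: invol_add invol_scale)

lemma subspace_P: "subspace P"
  unfolding P_part_def real_vector.subspace_def by (simp add: invol_add invol_scale)

lemma br_KP: "k \<in> K \<Longrightarrow> p \<in> P \<Longrightarrow> br k p \<in> P"
  unfolding K_part_def P_part_def by (simp add: invol_br)

lemma br_PP: "p \<in> P \<Longrightarrow> q \<in> P \<Longrightarrow> br p q \<in> K"
  unfolding K_part_def P_part_def by (simp add: invol_br)

lemma K_eq: "bracket_span br P P = K"
  using triple unfolding symplectic_symmetric_triple_def by - (elim conjE, assumption)

lemma faithful: "k \<in> K \<Longrightarrow> (\<And>p. p \<in> P \<Longrightarrow> br k p = 0) \<Longrightarrow> k = 0"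
proof -
  have "\<forall>k\<in>K. (\<forall>p\<in>P. br k p = 0) \<longrightarrow> k = 0"
    using triple unfolding symplectic_symmetric_triple_def by - (elim conjE, assumption)
  then show "k \<in> K \<Longrightarrow> (\<And>p. p \<in> P \<Longrightarrow> br k p = 0) \<Longrightarrow> k = 0" by fast
qed

lemma form_bilinear: "bilinear_on P \<Omega>"
  and form_anti: "x \<in> P \<Longrightarrow> y \<in> P \<Longrightarrow> \<Omega> x y = - \<Omega> y x"
  and form_nondegenerate: "x \<in> P \<Longrightarrow> (\<And>y. y \<in> P \<Longrightarrow> \<Omega> x y = 0) \<Longrightarrow> x = 0"
  and form_invariant: "k \<in> K \<Longrightarrow> x \<in> P \<Longrightarrow> y \<in> P \<Longrightarrow> \<Omega> (br k x) y + \<Omega> x (br k y) = 0"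
proof -
  have "symplectic_on P \<Omega>"
    and inv: "\<forall>k\<in>K. \<forall>x\<in>P. \<forall>y\<in>P. \<Omega> (br k x) y + \<Omega> x (br k y) = 0"
    using triple unfolding symplectic_symmetric_triple_def by - (elim conjE, assumption)+
  then have "bilinear_on P \<Omega>" "\<forall>x\<in>P. \<forall>y\<in>P. \<Omega> x y = - \<Omega> y x"
    "\<forall>x\<in>P. (\<forall>y\<in>P. \<Omega> x y = 0) \<longrightarrow> x = 0"
    unfolding symplectic_on_def by - (elim conjE, assumption)+
  with inv show "bilinear_on P \<Omega>"
    and "x \<in> P \<Longrightarrow> y \<in> P \<Longrightarrow> \<Omega> x y = - \<Omega> y x"
    and "x \<in> P \<Longrightarrow> (\<And>y. y \<in> P \<Longrightarrow> \<Omega> x y = 0) \<Longrightarrow> x = 0"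
    and "k \<in> K \<Longrightarrow> x \<in> P \<Longrightarrow> y \<in> P \<Longrightarrow> \<Omega> (br k x) y + \<Omega> x (br k y) = 0"
    by fast+
qed

lemma form_add_right: "x \<in> P \<Longrightarrow> y \<in> P \<Longrightarrow> z \<in> P \<Longrightarrow> \<Omega> x (y + z) = \<Omega> x y + \<Omega> x z"
  and form_add_left: "x \<in> P \<Longrightarrow> y \<in> P \<Longrightarrow> z \<in> P \<Longrightarrow> \<Omega> (x + y) z = \<Omega> x z + \<Omega> y z"
proof -
  have "linear_on P (\<Omega> x)" "linear_on P (\<lambda>x. \<Omega> x z)" if "x \<in> P" "z \<in> P"
    using form_bilinear that unfolding bilinear_on_def by blast+
  then show "x \<in> P \<Longrightarrow> y \<in> P \<Longrightarrow> z \<in> P \<Longrightarrow> \<Omega> x (y + z) = \<Omega> x y + \<Omega> x z"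
    and "x \<in> P \<Longrightarrow> y \<in> P \<Longrightarrow> z \<in> P \<Longrightarrow> \<Omega> (x + y) z = \<Omega> x z + \<Omega> y z"
    unfolding linear_on_def by simp_all
qed

lemma KP_decomposition:
  assumes S: "subspace S" "S \<subseteq> G" "\<And>x. x \<in> S \<Longrightarrow> \<sigma> x \<in> S" and x: "x \<in> S"
  obtains k p where "k \<in> K \<inter> S" "p \<in> P \<inter> S" "x = k + p"
proof -
  define k where "k = (1/2) *\<^sub>R (x + \<sigma> x)"
  define p where "p = (1/2) *\<^sub>R (x - \<sigma> x)"
  have xG: "x \<in> G" "\<sigma> x \<in> G" using x S by auto
  have mem: "k \<in> S" "p \<in> S"
    unfolding k_def p_def using x S(3)[OF x] S(1)
    by (intro real_vector.subspace_scale real_vector.subspace_add real_vector.subspace_diff; simp)+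
  have diff: "\<sigma> (x - \<sigma> x) = \<sigma> x - x"
    using invol_add[of x "(-1) *\<^sub>R \<sigma> x"] invol_scale[of "\<sigma> x" "-1"] xG by simp
  have "\<sigma> k = k"
    unfolding k_def using xG by (simp only: invol_scale invol_add add_mem invol_invol add.commute)
  moreover have "\<sigma> p = - p"
    unfolding p_def using xG
    by (simp only: invol_scale diff_mem diff scaleR_minus_right[symmetric] minus_diff_eq)
  moreover have "x = k + p"
    unfolding k_def p_def scaleR_add_right[symmetric] by simp
  moreover have "k \<in> G" "p \<in> G" using mem S(2) by auto
  ultimately have "k \<in> K \<inter> S" "p \<in> P \<inter> S" "x = k + p"
    using mem unfolding K_part_def P_part_def by simp_all
  then show ?thesis by (rule that)
qed

text \<open>A vector \<open>x \<in> P\<close> orthogonal to \<open>[K, P]\<close> satisfies \<open>[K, x] = 0\<close> by invariance of the form. Since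
  \<open>[x, P] \<subseteq> K\<close>, it follows that \<open>(ad x)\<^sup>2 = 0\<close>, and vanishing radical forces \<open>x = 0\<close>.\<close>

theorem semisimple_perfect:
  assumes ss: "lie_semisimple G br"
  shows "bracket_span br G G = G"
proof
  show "bracket_span br G G \<subseteq> G" by (rule bracket_span_least) auto
  let ?Q = "bracket_span br K P"
  have QP: "?Q \<subseteq> P" by (rule bracket_span_least) (auto intro: br_KP subspace_P)
  have Pfin: "finite_dim_subspace P"
    by (rule finite_dim_subspace_mono[OF fin subspace_P]) (auto intro: P_mem)
  have "?Q = P"
  proof (rule ccontr)
    assume "?Q \<noteq> P"
    then obtain x where x: "x \<in> P" "x \<noteq> 0" "\<And>q. q \<in> ?Q \<Longrightarrow> \<Omega> x q = 0"
      using exists_orthogonal_vector[OF Pfin form_bilinear subspace_bracket_span QP] by metis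
    have kx: "br k x = 0" if k: "k \<in> K" for k
    proof (rule form_nondegenerate[OF br_KP[OF k x(1)]])
      fix y assume y: "y \<in> P"
      have "\<Omega> x (br k y) = 0" using bracket_spanI[OF k y] by (rule x(3))
      then show "\<Omega> (br k x) y = 0" using form_invariant[OF k x(1) y] by simp
    qed
    have xG: "x \<in> G" using x(1) P_mem by blast
    have "br x (br x y) = 0" if y: "y \<in> G" for y
    proof -
      obtain k p where kp: "k \<in> K" "p \<in> P" "y = k + p"
        using KP_decomposition[OF sub subset_refl invol_mem y] by blast
      have "br x k = 0" using br_anti[of k x] kx[OF kp(1)] K_mem[OF kp(1)] xG by simp
      then have "br x y = br x p" using kp xG K_mem P_mem by simp
      moreover have xpK: "br x p \<in> K" using br_PP x(1) kp(2) by blast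
      ultimately show ?thesis
        using br_anti[of "br x p" x] kx[OF xpK] K_mem[OF xpK] xG by simp
    qed
    then have "x = 0" using semisimple_sandwich_zero[OF ss xG] by blast
    then show False using x(2) by blast
  qed
  then have "P \<subseteq> bracket_span br G G"
    using bracket_span_mono[of K G P G br] K_mem P_mem by blast
  moreover have "K \<subseteq> bracket_span br G G"
    using bracket_span_mono[of P G P G br] P_mem K_eq by blast
  ultimately have KP: "k + p \<in> bracket_span br G G" if "k \<in> K" "p \<in> P" for k p
    using that by (intro real_vector.subspace_add) auto
  show "G \<subseteq> bracket_span br G G"
  proof
    fix y assume y: "y \<in> G"
    obtain k p where "k \<in> K" "p \<in> P" "y = k + p"
      using KP_decomposition[OF sub subset_refl invol_mem y] by blast
    then show "y \<in> bracket_span br G G" using KP by simp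
  qed
qed

lemma ideals_commute:
  assumes "lie_ideal S G br" "lie_ideal T G br" "S \<inter> T = {0}" "x \<in> S" "y \<in> T"
  shows "br x y = 0"
proof -
  have L: "x \<in> G" "y \<in> G" using assms unfolding lie_ideal_def by auto
  have "br x y \<in> T" "br y x \<in> S" using assms L unfolding lie_ideal_def by auto
  moreover have "br x y = - br y x" using br_anti L by blast
  ultimately have "br x y \<in> S \<inter> T"
    using assms(1) unfolding lie_ideal_def by (simp add: real_vector.subspace_neg)
  then show ?thesis using assms(3) by blast
qed

text \<open>The one condition on triples that does not restrict to \<open>S\<close> at once is \<open>[P, P] = K\<close>. Since \<open>P\<close> splits
  along \<open>S\<close> and \<open>T\<close> and the two ideals commute, \<open>K = [P \<inter> S, P \<inter> S] + [P \<inter> T, P \<inter> T]\<close>, and taking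
  \<open>S\<close>-components gives the condition on \<open>S\<close>. Faithfulness and non-degeneracy pass to \<open>S\<close> because \<open>T\<close>
  commutes with \<open>S\<close> and is orthogonal to it.\<close>

lemma restrict_triple:
  assumes S: "lie_ideal S G br" "\<And>x. x \<in> S \<Longrightarrow> \<sigma> x \<in> S"
    and T: "lie_ideal T G br" "\<And>x. x \<in> T \<Longrightarrow> \<sigma> x \<in> T"
    and ST: "S \<inter> T = {0}" "G = {x + y | x y. x \<in> S \<and> y \<in> T}"
    and orth: "\<And>p q. p \<in> P \<inter> S \<Longrightarrow> q \<in> P \<inter> T \<Longrightarrow> \<Omega> p q = 0"
  shows "symplectic_symmetric_triple (t\<lparr>carrier := S\<rparr>)"
proof -
  have sS: "subspace S" "S \<subseteq> G" and sT: "subspace T" "T \<subseteq> G"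
    using S T unfolding lie_ideal_def by auto
  have SG: "x \<in> G" if "x \<in> S" for x using sS that by blast
  have TG: "x \<in> G" if "x \<in> T" for x using sT that by blast
  have Sbr: "br x y \<in> S" if "x \<in> G" "y \<in> S" for x y using S that unfolding lie_ideal_def by blast
  have comm: "br x y = 0" "br y x = 0" if "x \<in> S" "y \<in> T" for x y
    using ideals_commute[OF S(1) T(1) ST(1) that] br_anti[of x y] SG TG that by auto
  have split: "\<exists>a b. a \<in> P \<inter> S \<and> b \<in> P \<inter> T \<and> p = a + b" if p: "p \<in> P" for p
  proof -
    obtain x y where xy: "x \<in> S" "y \<in> T" "p = x + y" using ST(2) P_mem[OF p] by auto
    have "\<sigma> x + \<sigma> y = - (x + y)"
      using p xy SG TG invol_add[of x y] unfolding P_part_def by auto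
    then have "(\<sigma> x + \<sigma> y) + (x + y) = 0" by simp
    then have "(\<sigma> x + x) + (\<sigma> y + y) = 0" by (simp only: ac_simps)
    then have e: "\<sigma> x + x = - (\<sigma> y + y)" by (simp only: eq_neg_iff_add_eq_0)
    have "\<sigma> x + x \<in> S" "- (\<sigma> y + y) \<in> T"
      using xy S(2) T(2) sS sT by (intro real_vector.subspace_neg real_vector.subspace_add; blast)+
    then have "\<sigma> x + x \<in> S \<inter> T" using e by simp
    then have x0: "\<sigma> x + x = 0" using ST(1) by blast
    with e have "- (\<sigma> y + y) = 0" by (simp only:)
    then have "\<sigma> y + y = 0" by (rule neg_equal_0_iff_equal[THEN iffD1])
    with x0 show ?thesis
      using xy SG TG unfolding P_part_def by (auto simp: eq_neg_iff_add_eq_0)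
  qed
  have "lie_algebra S br"
    by (rule lie_subalgebra[OF sS]) (use SG Sbr in blast)
  moreover have "involutive_automorphism S br \<sigma>"
    unfolding involutive_automorphism_def linear_on_def
    using S(2) SG by (simp add: invol_add invol_scale invol_br)
  moreover have "bracket_span br (P \<inter> S) (P \<inter> S) = K \<inter> S"
  proof
    show "bracket_span br (P \<inter> S) (P \<inter> S) \<subseteq> K \<inter> S"
    proof (rule bracket_span_least)
      show "subspace (K \<inter> S)" using subspace_K sS by (simp add: real_vector.subspace_inter)
    qed (use br_PP Sbr SG in auto)
    let ?A = "bracket_span br (P \<inter> S) (P \<inter> S)"
    let ?B = "bracket_span br (P \<inter> T) (P \<inter> T)"
    have AS: "?A \<subseteq> S" by (rule bracket_span_least) (use Sbr SG sS in auto)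
    have BT: "?B \<subseteq> T"
      by (rule bracket_span_least) (use T TG sT in \<open>auto simp: lie_ideal_def\<close>)
    have "K \<subseteq> {a + b | a b. a \<in> ?A \<and> b \<in> ?B}"
      unfolding K_eq[symmetric]
    proof (rule bracket_span_least)
      show "subspace {a + b | a b. a \<in> ?A \<and> b \<in> ?B}"
        by (rule real_vector.subspace_sums) auto
      fix p q assume "p \<in> P" "q \<in> P"
      then obtain a b c d where pq: "a \<in> P \<inter> S" "b \<in> P \<inter> T" "p = a + b"
        "c \<in> P \<inter> S" "d \<in> P \<inter> T" "q = c + d"
        using split by metis
      have "br p q = br a c + br b d"
        using pq SG TG comm by simp
      moreover have "br a c \<in> ?A" "br b d \<in> ?B" using pq by (auto intro: bracket_spanI)
      ultimately show "br p q \<in> {a + b | a b. a \<in> ?A \<and> b \<in> ?B}" by blast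
    qed
    moreover have "a + b \<in> ?A" if "a \<in> ?A" "b \<in> ?B" "a + b \<in> S" for a b
    proof -
      have "(a + b) - a \<in> S"
        using that AS sS by (intro real_vector.subspace_diff) auto
      then have "b \<in> S \<inter> T" using that BT by auto
      then show ?thesis using that ST(1) by simp
    qed
    ultimately show "K \<inter> S \<subseteq> ?A" by blast
  qed
  moreover have "k = 0" if k: "k \<in> K \<inter> S" "\<forall>p\<in>P \<inter> S. br k p = 0" for k
  proof (rule faithful)
    fix p assume "p \<in> P"
    then obtain a b where ab: "a \<in> P \<inter> S" "b \<in> P \<inter> T" "p = a + b" using split by blast
    then show "br k p = 0" using k comm SG TG by simp
  qed (use k in blast)
  moreover have "symplectic_on (P \<inter> S) \<Omega>"
  proof -
    have "x = 0" if x: "x \<in> P \<inter> S" "\<forall>y\<in>P \<inter> S. \<Omega> x y = 0" for x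
    proof (rule form_nondegenerate)
      fix y assume "y \<in> P"
      then obtain a b where ab: "a \<in> P \<inter> S" "b \<in> P \<inter> T" "y = a + b" using split by blast
      then show "\<Omega> x y = 0" using x orth[of x b] by (simp add: form_add_right)
    qed (use x in blast)
    moreover have "bilinear_on (P \<inter> S) \<Omega>"
      using form_bilinear unfolding bilinear_on_def linear_on_def by blast
    moreover have "\<forall>x\<in>P \<inter> S. \<forall>y\<in>P \<inter> S. \<Omega> x y = - \<Omega> y x" using form_anti by blast
    ultimately show ?thesis unfolding symplectic_on_def by blast
  qed
  ultimately show ?thesis
    unfolding symplectic_symmetric_triple_def using sS form_invariant by simp
qed

theorem triple_direct_sum_restrict:
  assumes S: "lie_ideal S G br" "\<And>x. x \<in> S \<Longrightarrow> \<sigma> x \<in> S"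
    and T: "lie_ideal T G br" "\<And>x. x \<in> T \<Longrightarrow> \<sigma> x \<in> T"
    and ST: "S \<inter> T = {0}" "G = {x + y | x y. x \<in> S \<and> y \<in> T}"
    and orth: "\<And>p q. p \<in> P \<inter> S \<Longrightarrow> q \<in> P \<inter> T \<Longrightarrow> \<Omega> p q = 0"
  shows "triple_direct_sum t (t\<lparr>carrier := S\<rparr>) (t\<lparr>carrier := T\<rparr>)"
proof -
  have sS: "S \<subseteq> G" and sT: "T \<subseteq> G" using S T unfolding lie_ideal_def by auto
  have SG: "x \<in> G" if "x \<in> S" for x using sS that by blast
  have TG: "x \<in> G" if "x \<in> T" for x using sT that by blast
  have comm: "br x y = 0" "br y x = 0" if "x \<in> S" "y \<in> T" for x y
    using ideals_commute[OF S(1) T(1) ST(1) that] br_anti[of x y] SG TG that by auto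
  have orth': "\<Omega> q p = 0" if "p \<in> P \<inter> S" "q \<in> P \<inter> T" for p q
    using orth[OF that] form_anti[of q p] that by auto
  have TS: "T \<inter> S = {0}" "G = {x + y | x y. x \<in> T \<and> y \<in> S}"
    using ST by (auto simp: add.commute) (metis add.commute)+
  have "symplectic_symmetric_triple (t\<lparr>carrier := S\<rparr>)"
    by (rule restrict_triple[OF S T ST orth])
  moreover have "symplectic_symmetric_triple (t\<lparr>carrier := T\<rparr>)"
    by (rule restrict_triple[OF T S TS orth'])
  moreover have "br (x1 + x2) (y1 + y2) = br x1 y1 + br x2 y2"
    if "x1 \<in> S" "x2 \<in> T" "y1 \<in> S" "y2 \<in> T" for x1 x2 y1 y2
    using that SG TG comm by simp
  moreover have "\<sigma> (x1 + x2) = \<sigma> x1 + \<sigma> x2" if "x1 \<in> S" "x2 \<in> T" for x1 x2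
    using that SG TG invol_add by simp
  moreover have "\<Omega> (x1 + x2) (y1 + y2) = \<Omega> x1 y1 + \<Omega> x2 y2"
    if "x1 \<in> P \<inter> S" "x2 \<in> P \<inter> T" "y1 \<in> P \<inter> S" "y2 \<in> P \<inter> T" for x1 x2 y1 y2
    using that orth[of x1 y2] orth'[of y1 x2] real_vector.subspace_add[OF subspace_P]
    by (simp add: form_add_left form_add_right)
  ultimately show ?thesis
    unfolding triple_direct_sum_def using ST sS sT by simp
qed

end

section \<open>Direct sums of triples\<close>

lemma P_part_zero:
  assumes "symplectic_symmetric_triple t" shows "0 \<in> P_part t"
proof -
  interpret symp_triple t using assms by unfold_locales
  show ?thesis using subspace_P real_vector.subspace_0 by blast
qed

lemma triple_direct_sumD:
  assumes "triple_direct_sum t t1 t2"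
  shows "symplectic_symmetric_triple t1" "symplectic_symmetric_triple t2"
    and "carrier t = {x1 + x2 | x1 x2. x1 \<in> carrier t1 \<and> x2 \<in> carrier t2}"
    and "carrier t1 \<inter> carrier t2 = {0}"
    and "\<And>x1 x2 y1 y2. x1 \<in> carrier t1 \<Longrightarrow> x2 \<in> carrier t2 \<Longrightarrow> y1 \<in> carrier t1 \<Longrightarrow> y2 \<in> carrier t2 \<Longrightarrow>
      bracket t (x1 + x2) (y1 + y2) = bracket t1 x1 y1 + bracket t2 x2 y2"
    and "\<And>x1 x2. x1 \<in> carrier t1 \<Longrightarrow> x2 \<in> carrier t2 \<Longrightarrow> invol t (x1 + x2) = invol t1 x1 + invol t2 x2"
    and "\<And>x1 x2 y1 y2. x1 \<in> P_part t1 \<Longrightarrow> x2 \<in> P_part t2 \<Longrightarrow> y1 \<in> P_part t1 \<Longrightarrow> y2 \<in> P_part t2 \<Longrightarrow>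
      form t (x1 + x2) (y1 + y2) = form t1 x1 y1 + form t2 x2 y2"
proof -
  show "symplectic_symmetric_triple t1" "symplectic_symmetric_triple t2"
    and "carrier t = {x1 + x2 | x1 x2. x1 \<in> carrier t1 \<and> x2 \<in> carrier t2}"
    and "carrier t1 \<inter> carrier t2 = {0}"
    using assms unfolding triple_direct_sum_def by - (elim conjE, assumption)+
  have "\<forall>x1\<in>carrier t1. \<forall>x2\<in>carrier t2. \<forall>y1\<in>carrier t1. \<forall>y2\<in>carrier t2.
        bracket t (x1 + x2) (y1 + y2) = bracket t1 x1 y1 + bracket t2 x2 y2"
    and "\<forall>x1\<in>carrier t1. \<forall>x2\<in>carrier t2. invol t (x1 + x2) = invol t1 x1 + invol t2 x2"
    and "\<forall>x1\<in>P_part t1. \<forall>x2\<in>P_part t2. \<forall>y1\<in>P_part t1. \<forall>y2\<in>P_part t2.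
        form t (x1 + x2) (y1 + y2) = form t1 x1 y1 + form t2 x2 y2"
    using assms unfolding triple_direct_sum_def by - (elim conjE, assumption)+
  then show "\<And>x1 x2 y1 y2. x1 \<in> carrier t1 \<Longrightarrow> x2 \<in> carrier t2 \<Longrightarrow> y1 \<in> carrier t1 \<Longrightarrow> y2 \<in> carrier t2 \<Longrightarrow>
      bracket t (x1 + x2) (y1 + y2) = bracket t1 x1 y1 + bracket t2 x2 y2"
    and "\<And>x1 x2. x1 \<in> carrier t1 \<Longrightarrow> x2 \<in> carrier t2 \<Longrightarrow> invol t (x1 + x2) = invol t1 x1 + invol t2 x2"
    and "\<And>x1 x2 y1 y2. x1 \<in> P_part t1 \<Longrightarrow> x2 \<in> P_part t2 \<Longrightarrow> y1 \<in> P_part t1 \<Longrightarrow> y2 \<in> P_part t2 \<Longrightarrow>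
      form t (x1 + x2) (y1 + y2) = form t1 x1 y1 + form t2 x2 y2"
    by simp_all
qed

lemma triple_direct_sum_commute:
  assumes "triple_direct_sum t t1 t2" shows "triple_direct_sum t t2 t1"
proof -
  note d = triple_direct_sumD[OF assms]
  have "carrier t = {x1 + x2 |x1 x2. x1 \<in> carrier t2 \<and> x2 \<in> carrier t1}"
  proof -
    have "x \<in> carrier t \<longleftrightarrow> (\<exists>x1 x2. x = x1 + x2 \<and> x1 \<in> carrier t2 \<and> x2 \<in> carrier t1)" for x
      unfolding d(3) by (auto intro: add.commute)
    then show ?thesis by blast
  qed
  moreover have "bracket t (x1 + x2) (y1 + y2) = bracket t2 x1 y1 + bracket t1 x2 y2"
    if "x1 \<in> carrier t2" "x2 \<in> carrier t1" "y1 \<in> carrier t2" "y2 \<in> carrier t1" for x1 x2 y1 y2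
    using d(5)[OF that(2,1,4,3)] by (simp only: add.commute)
  moreover have "invol t (x1 + x2) = invol t2 x1 + invol t1 x2"
    if "x1 \<in> carrier t2" "x2 \<in> carrier t1" for x1 x2
    using d(6)[OF that(2,1)] by (simp only: add.commute)
  moreover have "form t (x1 + x2) (y1 + y2) = form t2 x1 y1 + form t1 x2 y2"
    if "x1 \<in> P_part t2" "x2 \<in> P_part t1" "y1 \<in> P_part t2" "y2 \<in> P_part t1" for x1 x2 y1 y2
    using d(7)[OF that(2,1,4,3)] by (simp only: add.commute)
  moreover have "carrier t2 \<inter> carrier t1 = {0}" using d(4) by (simp only: Int_commute)
  ultimately show ?thesis
    unfolding triple_direct_sum_def using d(1,2) by (intro conjI ballI) (assumption | rule refl)+
qed

text \<open>Only the first summand is treated: the decomposition is symmetric in its two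
  summands.\<close>

lemma triple_direct_sum_summand:
  assumes d: "triple_direct_sum t t1 t2"
  shows "symplectic_symmetric_triple t1"
    and "carrier t1 \<subseteq> carrier t"
    and "x \<in> carrier t1 \<Longrightarrow> y \<in> carrier t1 \<Longrightarrow> bracket t x y = bracket t1 x y"
    and "x \<in> carrier t1 \<Longrightarrow> invol t x = invol t1 x"
    and "lie_ideal (carrier t1) (carrier t) (bracket t)"
    and "P_part t1 = P_part t \<inter> carrier t1"
    and "x \<in> P_part t1 \<Longrightarrow> y \<in> P_part t1 \<Longrightarrow> form t x y = form t1 x y"
    and "x \<in> P_part t1 \<Longrightarrow> y \<in> P_part t2 \<Longrightarrow> form t x y = 0"
proof -
  note dd = triple_direct_sumD[OF d]
  interpret t1: symp_triple t1 using dd(1) by unfold_locales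
  interpret t2: symp_triple t2 using dd(2) by unfold_locales
  show "symplectic_symmetric_triple t1" by (rule t1.triple)
  show sub: "carrier t1 \<subseteq> carrier t"
  proof
    fix x assume "x \<in> carrier t1"
    then have "x = x + 0 \<and> x \<in> carrier t1 \<and> 0 \<in> carrier t2" by simp
    then show "x \<in> carrier t" unfolding dd(3) by blast
  qed
  note br = dd(5) and inv = dd(6) and form = dd(7)
  show "bracket t x y = bracket t1 x y" if "x \<in> carrier t1" "y \<in> carrier t1" for x y
    using br[OF that(1) t2.zero_mem that(2) t2.zero_mem] by simp
  show inv1: "invol t x = invol t1 x" if "x \<in> carrier t1" for x
    using inv[OF that t2.zero_mem] by simp
  show "lie_ideal (carrier t1) (carrier t) (bracket t)"
    unfolding lie_ideal_def
  proof (intro conjI ballI sub t1.sub)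
    fix x y assume "x \<in> carrier t" and y: "y \<in> carrier t1"
    then obtain x1 x2 where x: "x1 \<in> carrier t1" "x2 \<in> carrier t2" "x = x1 + x2"
      unfolding dd(3) by blast
    then show "bracket t x y \<in> carrier t1" using br[OF x(1,2) y t2.zero_mem] y by simp
  qed
  show "P_part t1 = P_part t \<inter> carrier t1"
    unfolding P_part_def using inv1 sub by auto
  have z: "0 \<in> P_part t1" "0 \<in> P_part t2"
    using P_part_zero t1.triple t2.triple by blast+
  have f0: "form t1 x 0 = 0" "form t1 0 x = 0" if "x \<in> P_part t1" for x
    using t1.form_add_right[OF that z(1) z(1)] t1.form_add_left[OF z(1) z(1) that] by simp_all
  have g0: "form t2 0 x = 0" if "x \<in> P_part t2" for x
    using t2.form_add_left[OF z(2) z(2) that] by simp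
  show "form t x y = form t1 x y" if "x \<in> P_part t1" "y \<in> P_part t1"
    using form[OF that(1) z(2) that(2) z(2)] g0[OF z(2)] by simp
  show "form t x y = 0" if "x \<in> P_part t1" "y \<in> P_part t2"
    using form[OF that(1) z(2) z(1) that(2)] f0(1)[OF that(1)] g0[OF that(2)] by simp
qed

text \<open>The involution preserves both summands, so the condition \<open>\<sigma> z = -z\<close> can be read off
  componentwise.\<close>

lemma triple_direct_sum_P_components:
  assumes d: "triple_direct_sum t t1 t2"
    and x: "x \<in> carrier t1" "y \<in> carrier t2" "x + y \<in> P_part t"
  shows "x \<in> P_part t1" "y \<in> P_part t2"
proof -
  note dd = triple_direct_sumD[OF d]
  interpret t1: symp_triple t1 using dd(1) by unfold_locales
  interpret t2: symp_triple t2 using dd(2) by unfold_locales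
  have "invol t (x + y) = invol t1 x + invol t2 y" using dd(6) x(1,2) by blast
  then have "(invol t1 x + x) + (invol t2 y + y) = 0"
    using x(3) unfolding P_part_def by (simp add: algebra_simps)
  then have e: "invol t1 x + x = - (invol t2 y + y)" by (simp only: eq_neg_iff_add_eq_0)
  have "invol t1 x + x \<in> carrier t1" "- (invol t2 y + y) \<in> carrier t2"
    using x(1,2) by (simp_all del: minus_add_distrib)
  then have "invol t1 x + x \<in> carrier t1 \<inter> carrier t2" using e by (simp only: Int_iff)
  then have x0: "invol t1 x + x = 0" using dd(4) by blast
  with e have "- (invol t2 y + y) = 0" by (simp only:)
  then have "invol t2 y + y = 0" by (rule neg_equal_0_iff_equal[THEN iffD1])
  with x0 show "x \<in> P_part t1" "y \<in> P_part t2"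
    using x unfolding P_part_def by (simp_all add: eq_neg_iff_add_eq_0)
qed

section \<open>Maximal semisimple factors\<close>

text \<open>With \<open>A = \<L>\<^sub>1 \<inter> \<L>\<^sub>2\<close>, \<open>S = \<L>\<^sub>1 \<inter> \<U>\<^sub>2\<close> and \<open>T = \<U>\<^sub>2 \<inter> (A + \<U>\<^sub>1)\<close>, perfectness of \<open>\<L>\<^sub>1\<close> yields
  \<open>\<L>\<^sub>1 = A \<oplus> S\<close>, and then the modular law yields \<open>\<U>\<^sub>2 = S \<oplus> T\<close>. The assumption on \<open>\<U>\<^sub>2\<close> forces
  \<open>S = 0\<close>.\<close>

lemma semisimple_subset_of_factor_free_complement:
  assumes t: "symplectic_symmetric_triple t"
    and d1: "triple_direct_sum t L1 U1" and ss: "lie_semisimple (carrier L1) (bracket L1)"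
    and d2: "triple_direct_sum t L2 U2"
    and max: "\<not> (\<exists>s. semisimple_factor U2 s \<and> carrier s \<noteq> {0})"
  shows "carrier L1 \<subseteq> carrier L2"
proof -
  interpret t: symp_triple t using t by unfold_locales
  note D1 = triple_direct_sumD[OF d1] and D2 = triple_direct_sumD[OF d2]
  interpret L1: symp_triple L1 using D1(1) by unfold_locales
  interpret U1: symp_triple U1 using D1(2) by unfold_locales
  interpret L2: symp_triple L2 using D2(1) by unfold_locales
  interpret U2: symp_triple U2 using D2(2) by unfold_locales
  note L1 = triple_direct_sum_summand[OF d1]
  note U1 = triple_direct_sum_summand[OF triple_direct_sum_commute[OF d1]]
  note L2 = triple_direct_sum_summand[OF d2]
  note U2 = triple_direct_sum_summand[OF triple_direct_sum_commute[OF d2]]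
  let ?br = "bracket t"
  define A where "A = carrier L1 \<inter> carrier L2"
  define S where "S = carrier L1 \<inter> carrier U2"
  define W where "W = {a + u | a u. a \<in> A \<and> u \<in> carrier U1}"
  define T where "T = carrier U2 \<inter> W"
  have sub: "subspace A" "subspace S" "subspace W" "subspace T"
    unfolding A_def S_def T_def W_def
    by (intro real_vector.subspace_inter real_vector.subspace_sums L1.sub L2.sub U1.sub U2.sub)+
  have A_D: "x \<in> carrier L1" "x \<in> carrier L2" if "x \<in> A" for x using that unfolding A_def by auto
  have S_D: "x \<in> carrier L1" "x \<in> carrier U2" if "x \<in> S" for x using that unfolding S_def by auto
  have T_D: "x \<in> carrier U2" "x \<in> W" if "x \<in> T" for x using that unfolding T_def by auto
  have tL1: "x \<in> carrier t" if "x \<in> carrier L1" for x using L1(2) that by blast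
  have tU1: "x \<in> carrier t" if "x \<in> carrier U1" for x using U1(2) that by blast
  have tU2: "x \<in> carrier t" if "x \<in> carrier U2" for x using U2(2) that by blast
  have idealD: "?br y x \<in> I" if "lie_ideal I (carrier t) ?br" "x \<in> I" "y \<in> carrier t" for I x y
    using that unfolding lie_ideal_def by blast
  have idealD': "?br x y \<in> I" if I: "lie_ideal I (carrier t) ?br" and "x \<in> I" "y \<in> carrier t" for I x y
  proof -
    have "subspace I" "x \<in> carrier t" using that unfolding lie_ideal_def by auto
    then have "- ?br y x \<in> I" using idealD[OF that] by (simp add: real_vector.subspace_neg)
    then show ?thesis using t.br_anti[OF \<open>y \<in> carrier t\<close> \<open>x \<in> carrier t\<close>] by simp
  qed
  have AS: "carrier L1 \<subseteq> {a + s | a s. a \<in> A \<and> s \<in> S}"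
  proof -
    have "bracket_span (bracket L1) (carrier L1) (carrier L1) \<subseteq> {a + s | a s. a \<in> A \<and> s \<in> S}"
    proof (rule bracket_span_least)
      show "subspace {a + s | a s. a \<in> A \<and> s \<in> S}"
        by (intro real_vector.subspace_sums sub)
      fix x y assume x: "x \<in> carrier L1" and y: "y \<in> carrier L1"
      have "y \<in> carrier t" using tL1[OF y] .
      then obtain v w where vw: "v \<in> carrier L2" "w \<in> carrier U2" "y = v + w"
        unfolding D2(3) by blast
      have m: "v \<in> carrier t" "w \<in> carrier t" "x \<in> carrier t"
        using vw x L1(2) L2(2) U2(2) by auto
      have "bracket L1 x y = ?br x v + ?br x w"
        using L1(3)[OF x y] vw(3) m by simp
      moreover have "?br x v \<in> A"
        unfolding A_def using idealD'[OF L1(5) x m(1)] idealD[OF L2(5) vw(1) m(3)] by blast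
      moreover have "?br x w \<in> S"
        unfolding S_def using idealD'[OF L1(5) x m(2)] idealD[OF U2(5) vw(2) m(3)] by blast
      ultimately show "bracket L1 x y \<in> {a + s | a s. a \<in> A \<and> s \<in> S}" by blast
    qed
    then show ?thesis using L1.semisimple_perfect[OF ss] by simp
  qed
  have AS0: "A \<inter> S = {0}"
  proof -
    have "A \<inter> S \<subseteq> carrier L2 \<inter> carrier U2" unfolding A_def S_def by auto
    then have "A \<inter> S \<subseteq> {0}" using D2(4) by simp
    then show ?thesis using real_vector.subspace_0[OF sub(1)] real_vector.subspace_0[OF sub(2)] by auto
  qed
  have ST0: "S \<inter> T = {0}"
  proof -
    have "x = 0" if x: "x \<in> S" "x \<in> T" for x
    proof -
      obtain a u where au: "a \<in> A" "u \<in> carrier U1" "x = a + u"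
        using T_D(2)[OF x(2)] unfolding W_def by blast
      have "x - a \<in> carrier L1" using S_D(1)[OF x(1)] A_D(1)[OF au(1)] by simp
      then have "u \<in> carrier L1 \<inter> carrier U1" using au by simp
      then have "u = 0" using D1(4) by blast
      then have "x \<in> A \<inter> S" using au x by simp
      then show ?thesis using AS0 by blast
    qed
    then show ?thesis using real_vector.subspace_0[OF sub(2)] real_vector.subspace_0[OF sub(4)] by blast
  qed
  have cover: "carrier U2 = {s + v | s v. s \<in> S \<and> v \<in> T}"
  proof
    show "carrier U2 \<subseteq> {s + v | s v. s \<in> S \<and> v \<in> T}"
    proof
      fix x assume x: "x \<in> carrier U2"
      have "x \<in> carrier t" using tU2[OF x] .
      then obtain l u where lu: "l \<in> carrier L1" "u \<in> carrier U1" "x = l + u"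
        unfolding D1(3) by blast
      then obtain a s where as: "a \<in> A" "s \<in> S" "l = a + s" using AS by blast
      have eq: "x - s = a + u" using lu(3) as(3) by simp
      have "x - s \<in> carrier U2" using x S_D(2)[OF as(2)] by simp
      moreover have "x - s \<in> W" unfolding W_def eq using as(1) lu(2) by blast
      ultimately have "x - s \<in> T" unfolding T_def by simp
      moreover have "x = s + (x - s)" by simp
      ultimately show "x \<in> {s + v | s v. s \<in> S \<and> v \<in> T}" using as(2) by blast
    qed
    show "{s + v | s v. s \<in> S \<and> v \<in> T} \<subseteq> carrier U2" using S_D(2) T_D(1) by auto
  qed
  have Sideal: "lie_ideal S (carrier U2) (bracket U2)"
    unfolding lie_ideal_def
  proof (intro conjI ballI sub)
    show "S \<subseteq> carrier U2" using S_D by blast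
    fix x y assume x: "x \<in> carrier U2" and y: "y \<in> S"
    have "bracket U2 x y = ?br x y" using U2(3)[OF x S_D(2)[OF y]] by simp
    moreover have "?br x y \<in> carrier L1" by (rule idealD[OF L1(5) S_D(1)[OF y] tU2[OF x]])
    moreover have "?br x y \<in> carrier U2" by (rule idealD[OF U2(5) S_D(2)[OF y] tU2[OF x]])
    ultimately show "bracket U2 x y \<in> S" unfolding S_def by simp
  qed
  have Tideal: "lie_ideal T (carrier U2) (bracket U2)"
    unfolding lie_ideal_def
  proof (intro conjI ballI sub)
    show "T \<subseteq> carrier U2" using T_D by blast
    fix x y assume x: "x \<in> carrier U2" and y: "y \<in> T"
    obtain a u where au: "a \<in> A" "u \<in> carrier U1" "y = a + u"
      using T_D(2)[OF y] unfolding W_def by blast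
    have xt: "x \<in> carrier t" using tU2[OF x] .
    have "?br x y = ?br x a + ?br x u" using au xt tL1 tU1 A_D by simp
    moreover have "?br x a \<in> A"
      unfolding A_def using idealD[OF L1(5) A_D(1)[OF au(1)] xt] idealD[OF L2(5) A_D(2)[OF au(1)] xt]
      by blast
    moreover have "?br x u \<in> carrier U1" by (rule idealD[OF U1(5) au(2) xt])
    ultimately have "?br x y \<in> W" unfolding W_def by blast
    moreover have "bracket U2 x y = ?br x y" using U2(3)[OF x T_D(1)[OF y]] by simp
    moreover have "?br x y \<in> carrier U2" by (rule idealD[OF U2(5) T_D(1)[OF y] xt])
    ultimately show "bracket U2 x y \<in> T" unfolding T_def by simp
  qed
  have Sinv: "invol U2 x \<in> S" if x: "x \<in> S" for x
  proof -
    have "invol U2 x = invol L1 x" using U2(4)[OF S_D(2)[OF x]] L1(4)[OF S_D(1)[OF x]] by simp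
    then have "invol U2 x \<in> carrier L1" using S_D(1)[OF x] by simp
    moreover have "invol U2 x \<in> carrier U2" using S_D(2)[OF x] by simp
    ultimately show ?thesis unfolding S_def by simp
  qed
  have Tinv: "invol U2 x \<in> T" if x: "x \<in> T" for x
  proof -
    obtain a u where au: "a \<in> A" "u \<in> carrier U1" "x = a + u"
      using T_D(2)[OF x] unfolding W_def by blast
    have "invol U2 x = invol t x" using U2(4)[OF T_D(1)[OF x]] by simp
    also have "\<dots> = invol L1 a + invol U1 u" unfolding au(3) by (rule D1(6)[OF A_D(1)[OF au(1)] au(2)])
    finally have e: "invol U2 x = invol L1 a + invol U1 u" .
    have "invol L1 a = invol L2 a" using L1(4)[OF A_D(1)[OF au(1)]] L2(4)[OF A_D(2)[OF au(1)]] by simp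
    moreover have "invol L1 a \<in> carrier L1" "invol L2 a \<in> carrier L2" using A_D[OF au(1)] by simp_all
    ultimately have "invol L1 a \<in> A" unfolding A_def by simp
    moreover have "invol U1 u \<in> carrier U1" using au(2) by simp
    ultimately have "invol U2 x \<in> W" unfolding W_def e by blast
    moreover have "invol U2 x \<in> carrier U2" using T_D(1)[OF x] by simp
    ultimately show ?thesis unfolding T_def by simp
  qed
  \<comment> \<open>\<open>S\<close> is orthogonal to \<open>\<U>\<^sub>1\<close> as a part of \<open>\<L>\<^sub>1\<close>, and to \<open>A \<subseteq> \<L>\<^sub>2\<close> as a part of \<open>\<U>\<^sub>2\<close>\<close>
  have orth: "form U2 p q = 0" if p: "p \<in> P_part U2 \<inter> S" and q: "q \<in> P_part U2 \<inter> T" for p q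
  proof -
    obtain a u where au: "a \<in> A" "u \<in> carrier U1" "q = a + u"
      using q T_D(2) unfolding W_def by blast
    have qt: "a + u \<in> P_part t" and pt: "p \<in> P_part t" using p q U2(6) au(3) by auto
    have aP: "a \<in> P_part L1" "u \<in> P_part U1"
      using triple_direct_sum_P_components[OF d1 A_D(1)[OF au(1)] au(2) qt] by auto
    then have at: "a \<in> P_part t" "u \<in> P_part t" using L1(6) U1(6) by auto
    have "p \<in> P_part L1" using pt p S_D(1) L1(6) by auto
    then have 1: "form t p u = 0" using L1(8) aP(2) by blast
    have "a \<in> P_part L2" using at(1) A_D(2)[OF au(1)] L2(6) by auto
    then have 2: "form t p a = 0" using U2(8) p by blast
    have "form U2 p q = form t p q" using U2(7) p q by auto
    also have "\<dots> = form t p a + form t p u" unfolding au(3) by (rule t.form_add_right[OF pt at])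
    finally show ?thesis using 1 2 by simp
  qed
  have dS: "triple_direct_sum U2 (U2\<lparr>carrier := S\<rparr>) (U2\<lparr>carrier := T\<rparr>)"
    by (rule U2.triple_direct_sum_restrict[OF Sideal Sinv Tideal Tinv ST0 cover orth])
  have "lie_semisimple S (bracket U2)"
  proof (rule lie_semisimple_direct_factor[OF ss sub(2)])
    show "S \<subseteq> carrier L1" using S_D by blast
    show "bracket U2 x y \<in> S" if "x \<in> S" "y \<in> S" for x y
      using Sideal that S_D(2) unfolding lie_ideal_def by blast
    show eqS: "bracket L1 x y = bracket U2 x y" if "x \<in> S" "y \<in> S" for x y
      using L1(3)[OF S_D(1)[OF that(1)] S_D(1)[OF that(2)]]
        U2(3)[OF S_D(2)[OF that(1)] S_D(2)[OF that(2)]] by simp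
    show "\<exists>s\<in>S. \<forall>y\<in>S. bracket L1 x y = bracket U2 s y" if x: "x \<in> carrier L1" for x
    proof -
      obtain a s where as: "a \<in> A" "s \<in> S" "x = a + s" using AS x by blast
      have "bracket L1 x y = bracket U2 s y" if y: "y \<in> S" for y
      proof -
        have "?br a y = 0"
          by (rule t.ideals_commute[OF L2(5) U2(5) D2(4) A_D(2)[OF as(1)] S_D(2)[OF y]])
        then have "bracket L1 a y = 0" using L1(3)[OF A_D(1)[OF as(1)] S_D(1)[OF y]] by simp
        then show ?thesis using as A_D(1) S_D(1) y eqS by simp
      qed
      then show ?thesis using as(2) by blast
    qed
  qed
  then have "semisimple_factor U2 (U2\<lparr>carrier := S\<rparr>)"
    unfolding semisimple_factor_def semisimple_triple_def
    using dS triple_direct_sumD(1)[OF dS] by auto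
  then have S0: "S = {0}" using max by fastforce
  show ?thesis
  proof
    fix x assume "x \<in> carrier L1"
    then obtain a s where as: "a \<in> A" "s \<in> S" "x = a + s" using AS by blast
    then show "x \<in> carrier L2" using S0 A_D(2) by simp
  qed
qed

lemma zero_factor:
  assumes t: "symplectic_symmetric_triple t"
  shows "triple_direct_sum t (t\<lparr>carrier := {0}\<rparr>) t"
    and "semisimple_triple (t\<lparr>carrier := {0}\<rparr>)"
proof -
  interpret t: symp_triple t using t by unfold_locales
  have "triple_direct_sum t (t\<lparr>carrier := {0}\<rparr>) (t\<lparr>carrier := carrier t\<rparr>)"
  proof (rule t.triple_direct_sum_restrict)
    show "form t p q = 0" if "p \<in> P_part t \<inter> {0}" "q \<in> P_part t \<inter> carrier t" for p q
      using that t.form_add_left[of 0 0 q] by auto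
  qed (auto simp: lie_ideal_def real_vector.subspace_single_0)
  then show d: "triple_direct_sum t (t\<lparr>carrier := {0}\<rparr>) t" by simp
  have "lie_semisimple {0} (bracket t)"
    unfolding lie_semisimple_def lie_ideal_def
    using real_vector.subspace_0 by blast
  then show "semisimple_triple (t\<lparr>carrier := {0}\<rparr>)"
    unfolding semisimple_triple_def using triple_direct_sumD(1)[OF d] by simp
qed

text \<open>From \<open>t = L \<oplus> U\<close> and \<open>U = R \<oplus> V\<close> one regroups \<open>t = (L \<oplus> R) \<oplus> V\<close>.\<close>

lemma enlarge_semisimple_factor:
  assumes t: "symplectic_symmetric_triple t"
    and d: "triple_direct_sum t L U" and L: "semisimple_triple L"
    and d': "triple_direct_sum U R V" and R: "semisimple_triple R"
  defines "W \<equiv> {x + y | x y. x \<in> carrier L \<and> y \<in> carrier R}"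
  shows "triple_direct_sum t (t\<lparr>carrier := W\<rparr>) (t\<lparr>carrier := carrier V\<rparr>)"
    and "semisimple_triple (t\<lparr>carrier := W\<rparr>)"
proof -
  interpret t: symp_triple t using t by unfold_locales
  note D = triple_direct_sumD[OF d] and D' = triple_direct_sumD[OF d']
  interpret L: symp_triple L using D(1) by unfold_locales
  interpret U: symp_triple U using D(2) by unfold_locales
  interpret R: symp_triple R using D'(1) by unfold_locales
  interpret V: symp_triple V using D'(2) by unfold_locales
  note Ls = triple_direct_sum_summand[OF d]
  note Us = triple_direct_sum_summand[OF triple_direct_sum_commute[OF d]]
  note Rs = triple_direct_sum_summand[OF d']
  note Vs = triple_direct_sum_summand[OF triple_direct_sum_commute[OF d']]
  let ?br = "bracket t"
  have tL: "x \<in> carrier t" if "x \<in> carrier L" for x using Ls(2) that by blast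
  have tU: "x \<in> carrier t" if "x \<in> carrier U" for x using Us(2) that by blast
  have RU: "x \<in> carrier U" if "x \<in> carrier R" for x using Rs(2) that by blast
  have VU: "x \<in> carrier U" if "x \<in> carrier V" for x using Vs(2) that by blast
  have ideal_trans: "lie_ideal I (carrier t) ?br"
    if I: "lie_ideal I (carrier U) (bracket U)" for I
    unfolding lie_ideal_def
  proof (intro conjI ballI)
    show "subspace I" using I unfolding lie_ideal_def by simp
    have IU: "x \<in> carrier U" if "x \<in> I" for x using I that unfolding lie_ideal_def by blast
    show "I \<subseteq> carrier t" using IU tU by blast
    fix x y assume x: "x \<in> carrier t" and y: "y \<in> I"
    obtain l u where lu: "l \<in> carrier L" "u \<in> carrier U" "x = l + u"
      using x unfolding D(3) by blast
    have "?br x y = bracket L l 0 + bracket U u y"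
      using D(5)[OF lu(1,2) L.zero_mem IU[OF y]] lu(3) by simp
    also have "\<dots> = bracket U u y" using lu(1) by simp
    finally show "?br x y \<in> I" using I lu(2) y unfolding lie_ideal_def by simp
  qed
  have Rt: "lie_ideal (carrier R) (carrier t) ?br" by (rule ideal_trans[OF Rs(5)])
  have Vt: "lie_ideal (carrier V) (carrier t) ?br" by (rule ideal_trans[OF Vs(5)])
  have sW: "subspace W" unfolding W_def by (intro real_vector.subspace_sums L.sub R.sub)
  have Wideal: "lie_ideal W (carrier t) ?br"
    unfolding lie_ideal_def
  proof (intro conjI ballI sW)
    show "W \<subseteq> carrier t" unfolding W_def using tL tU RU by auto
    fix x y assume x: "x \<in> carrier t" and y: "y \<in> W"
    obtain l r where lr: "l \<in> carrier L" "r \<in> carrier R" "y = l + r" using y unfolding W_def by blast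
    have "?br x y = ?br x l + ?br x r" using x lr tL tU RU by simp
    moreover have "?br x l \<in> carrier L" using Ls(5) x lr(1) unfolding lie_ideal_def by simp
    moreover have "?br x r \<in> carrier R" using Rt x lr(2) unfolding lie_ideal_def by simp
    ultimately show "?br x y \<in> W" unfolding W_def by blast
  qed
  have Winv: "invol t x \<in> W" if x: "x \<in> W" for x
  proof -
    obtain l r where lr: "l \<in> carrier L" "r \<in> carrier R" "x = l + r" using x unfolding W_def by blast
    have "invol t x = invol L l + invol U r" using D(6)[OF lr(1) RU[OF lr(2)]] lr(3) by simp
    also have "\<dots> = invol L l + invol R r" using Rs(4)[OF lr(2)] by simp
    finally have "invol t x = invol L l + invol R r" .
    moreover have "invol L l \<in> carrier L" "invol R r \<in> carrier R" using lr by simp_all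
    ultimately show ?thesis unfolding W_def by blast
  qed
  have Vinv: "invol t x \<in> carrier V" if x: "x \<in> carrier V" for x
    using Us(4)[OF VU[OF x]] Vs(4)[OF x] x by simp
  have WV0: "W \<inter> carrier V = {0}"
  proof -
    have "x = 0" if x: "x \<in> W" "x \<in> carrier V" for x
    proof -
      obtain l r where lr: "l \<in> carrier L" "r \<in> carrier R" "x = l + r" using x unfolding W_def by blast
      have "x - r \<in> carrier U" using VU[OF x(2)] RU[OF lr(2)] by simp
      then have "l \<in> carrier L \<inter> carrier U" using lr by simp
      then have "l = 0" using D(4) by blast
      then have "x \<in> carrier R \<inter> carrier V" using lr x by simp
      then show ?thesis using D'(4) by blast
    qed
    then show ?thesis using real_vector.subspace_0[OF sW] by auto
  qed
  have cover: "carrier t = {x + y | x y. x \<in> W \<and> y \<in> carrier V}"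
  proof
    show "carrier t \<subseteq> {x + y | x y. x \<in> W \<and> y \<in> carrier V}"
    proof
      fix x assume "x \<in> carrier t"
      then obtain l u where lu: "l \<in> carrier L" "u \<in> carrier U" "x = l + u" unfolding D(3) by blast
      then obtain r v where rv: "r \<in> carrier R" "v \<in> carrier V" "u = r + v" unfolding D'(3) by blast
      have "x = (l + r) + v" using lu rv by (simp add: add.assoc)
      moreover have "l + r \<in> W" unfolding W_def using lu rv by blast
      ultimately show "x \<in> {x + y | x y. x \<in> W \<and> y \<in> carrier V}" using rv by blast
    qed
    show "{x + y | x y. x \<in> W \<and> y \<in> carrier V} \<subseteq> carrier t"
      using Wideal tU VU unfolding lie_ideal_def by auto
  qed
  have orth: "form t p q = 0" if p: "p \<in> P_part t \<inter> W" and q: "q \<in> P_part t \<inter> carrier V" for p q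
  proof -
    obtain l r where lr: "l \<in> carrier L" "r \<in> carrier R" "p = l + r" using p unfolding W_def by blast
    have c: "l \<in> P_part L" "r \<in> P_part U"
      using triple_direct_sum_P_components[OF d lr(1) RU[OF lr(2)]] p lr(3) by auto
    have qU: "q \<in> P_part U" using q VU Us(6) by auto
    have qV: "q \<in> P_part V" using qU q Vs(6) by auto
    have rR: "r \<in> P_part R" using c(2) lr(2) Rs(6) by auto
    have "form t p q = form t l q + form t r q"
      unfolding lr(3) using c qU Ls(6) Us(6) by (intro t.form_add_left) auto
    also have "form t l q = 0" by (rule Ls(8)[OF c(1) qU])
    also have "form t r q = form U r q" by (rule Us(7)[OF c(2) qU])
    also have "form U r q = 0" by (rule Rs(8)[OF rR qV])
    finally show ?thesis by simp
  qed
  show dW: "triple_direct_sum t (t\<lparr>carrier := W\<rparr>) (t\<lparr>carrier := carrier V\<rparr>)"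
    by (rule t.triple_direct_sum_restrict[OF Wideal Winv Vt Vinv WV0 cover orth])
  have "lie_semisimple W ?br"
    unfolding W_def
  proof (rule t.lie_semisimple_sum[OF L.sub Ls(2) _ _ R.sub])
    show "?br x y \<in> carrier L" if "x \<in> carrier L" "y \<in> carrier L" for x y
      using Ls(3)[OF that] that by simp
    show "carrier R \<subseteq> carrier t" using RU tU by blast
    have brR: "?br x y = bracket R x y" if "x \<in> carrier R" "y \<in> carrier R" for x y
      using Us(3)[OF RU[OF that(1)] RU[OF that(2)]] Rs(3)[OF that] by simp
    show "?br x y \<in> carrier R" if "x \<in> carrier R" "y \<in> carrier R" for x y
      using brR[OF that] that by simp
    show "lie_semisimple (carrier L) ?br"
    proof (rule lie_semisimple_direct_factor)
      show "lie_semisimple (carrier L) (bracket L)" using L unfolding semisimple_triple_def by simp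
    qed (use Ls(3) in auto)
    show "lie_semisimple (carrier R) ?br"
    proof (rule lie_semisimple_direct_factor)
      show "lie_semisimple (carrier R) (bracket R)" using R unfolding semisimple_triple_def by simp
    qed (use brR in auto)
    show "?br x y = 0" if "x \<in> carrier L" "y \<in> carrier R" for x y
      by (rule t.ideals_commute[OF Ls(5) Us(5) D(4) that(1) RU[OF that(2)]])
  qed
  then show "semisimple_triple (t\<lparr>carrier := W\<rparr>)"
    unfolding semisimple_triple_def using triple_direct_sumD(1)[OF dW] by simp
qed

lemma exists_maximal_semisimple_decomposition:
  assumes t: "symplectic_symmetric_triple t"
  shows "\<exists>tL t1. maximal_semisimple_decomposition t tL t1"
proof -
  interpret t: symp_triple t using t by unfold_locales
  define good where "good p \<longleftrightarrow> semisimple_triple (fst p) \<and> triple_direct_sum t (fst p) (snd p)"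
    for p :: "'a triple \<times> 'a triple"
  have fin: "finite_dim_subspace (carrier t)" by (rule t.fin)
  have "good (t\<lparr>carrier := {0}\<rparr>, t)" unfolding good_def using zero_factor[OF t] by simp
  moreover have "dim (carrier (fst p)) < Suc (dim (carrier t))" if "good p" for p
    using triple_direct_sum_summand(2)[of t "fst p" "snd p"] dim_le_of_subset[OF fin] that
    unfolding good_def by (simp add: less_Suc_eq_le)
  ultimately obtain p where p: "good p"
    and max: "\<And>q. good q \<Longrightarrow> dim (carrier (fst q)) \<le> dim (carrier (fst p))"
    using ex_has_greatest_nat[of good _ "\<lambda>p. dim (carrier (fst p))" "Suc (dim (carrier t))"]
    by metis
  obtain L U where LU: "p = (L, U)" by (cases p)
  have L: "semisimple_triple L" and d: "triple_direct_sum t L U"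
    using p unfolding good_def LU by auto
  have "carrier R = {0}" if R: "semisimple_factor U R" for R
  proof -
    obtain V where d': "triple_direct_sum U R V" and ssR: "semisimple_triple R"
      using R unfolding semisimple_factor_def by blast
    note D = triple_direct_sumD[OF d] and D' = triple_direct_sumD[OF d']
    interpret L: symp_triple L using D(1) by unfold_locales
    interpret R: symp_triple R using D'(1) by unfold_locales
    define W where "W = {x + y | x y. x \<in> carrier L \<and> y \<in> carrier R}"
    have e: "triple_direct_sum t (t\<lparr>carrier := W\<rparr>) (t\<lparr>carrier := carrier V\<rparr>)"
      "semisimple_triple (t\<lparr>carrier := W\<rparr>)"
      unfolding W_def by (rule enlarge_semisimple_factor[OF t d L d' ssR])+
    have Wt: "W \<subseteq> carrier t" using triple_direct_sum_summand(2)[OF e(1)] by simp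
    have "dim W \<le> dim (carrier L)"
      using max[of "(t\<lparr>carrier := W\<rparr>, t\<lparr>carrier := carrier V\<rparr>)"] e unfolding good_def LU by simp
    moreover have "finite_dim_subspace W"
      unfolding W_def
      by (rule finite_dim_subspace_mono[OF fin])
        (use Wt in \<open>simp_all add: W_def real_vector.subspace_sums\<close>)
    moreover have LW: "x \<in> W" if "x \<in> carrier L" for x
      unfolding W_def using that R.zero_mem by force
    ultimately have "carrier L = W" using subspace_eq_of_dim_le[of W "carrier L"] by auto
    moreover have "x \<in> W" if "x \<in> carrier R" for x
      unfolding W_def using that L.zero_mem by force
    ultimately have "carrier R \<subseteq> carrier L \<inter> carrier U"
      using triple_direct_sum_summand(2)[OF d'] by auto
    then show ?thesis using D(4) R.zero_mem by auto
  qed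
  then show ?thesis using L d unfolding maximal_semisimple_decomposition_def by blast
qed

theorem proposition4p1p2:
  fixes t :: "'a::real_vector triple"
  assumes "symplectic_symmetric_triple t"
    and "\<not> lie_solvable (carrier t) (bracket t)"
    and "\<not> lie_semisimple (carrier t) (bracket t)"
  shows "(\<exists>tL t1. maximal_semisimple_decomposition t tL t1) \<and>
    (\<forall>tL1 t1 tL2 t2.
       maximal_semisimple_decomposition t tL1 t1 \<and> maximal_semisimple_decomposition t tL2 t2
       \<longrightarrow> carrier tL1 = carrier tL2)"
proof (intro conjI allI impI exists_maximal_semisimple_decomposition assms(1))
  fix tL1 t1 tL2 t2
  assume "maximal_semisimple_decomposition t tL1 t1 \<and> maximal_semisimple_decomposition t tL2 t2"
  then have d: "lie_semisimple (carrier tL1) (bracket tL1)" "triple_direct_sum t tL1 t1"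
    "lie_semisimple (carrier tL2) (bracket tL2)" "triple_direct_sum t tL2 t2"
    and max: "\<not> (\<exists>s. semisimple_factor t1 s \<and> carrier s \<noteq> {0})"
    "\<not> (\<exists>s. semisimple_factor t2 s \<and> carrier s \<noteq> {0})"
    unfolding maximal_semisimple_decomposition_def semisimple_triple_def by simp_all
  show "carrier tL1 = carrier tL2"
    using semisimple_subset_of_factor_free_complement[OF assms(1) d(2,1,4) max(2)]
      semisimple_subset_of_factor_free_complement[OF assms(1) d(4,3,2) max(1)]
    by (rule subset_antisym)
qed

end
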